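(* There exist an absolute constant $k_0$ and a constant $\beta^{*}<1$ such that for every integer $k\ge k_0$ the $k$-colouring model is reconstructible for both $\mathcal{T}_{d}$ and $\mathcal{T}_{\mathrm{Pois}(d)}$ for every $d$ satisfying $$d\ge k(\log k+\log\log k+\beta^{*}).$$ (For $\mathcal{T}_d$, $d$ is an integer; for $\mathcal{T}_{\mathrm{Pois}(d)}$, $d$ is a real number.)
   Context: For a probability distribution $\xi$ on the non-negative integers, $\mathcal{T}_\xi$ denotes the law of the Galton-Watson tree with offspring distribution $\xi$ and root $\rho$. $\mathcal{T}_d$ is the (deterministic) $d$-ary tree (every vertex has exactly $d$ children) and $\mathcal{T}_{\mathrm{Pois}(d)}$ is the Galton-Watson tree with Poisson offspring distribution of mean $d$. The $k$-colouring model on a rooted tree $T$ is the following random configuration $\sigma$ with values in $[k]=\{1,\dots,k\}$: the root spin $\sigma_\rho$ is uniform on $[k]$, and, going down the tree, each vertex $v$ with parent $u$ receives, conditionally on $\sigma_u$ and independently of everything else above, a spin $\sigma_v$ uniform on $[k]\setminus\{\sigma_u\}$. $T_n$ denotes the first $n$ levels of $T$ and $L_n$ the set of vertices of $T$ at level $n$ (with $T_n=T$, $L_n=\varnothing$ if $T$ has fewer than $n$ levels). The $k$-colouring model is called reconstructible for $\mathcal{T}_\xi$ if there exist $i,j\in[k]$ such that $$\limsup_{n\to\infty}\ \mathbb{E}_{T\sim\mathcal{T}_\xi}\, d_{\mathrm{TV}}\big(P(\sigma_{L_n}=\cdot\mid T,\sigma_\rho=i),\,P(\sigma_{L_n}=\cdot\mid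 T,\sigma_\rho=j)\big)>0,$$ where $d_{\mathrm{TV}}$ is total-variation distance. *)

theory Defs
  imports "HOL-Probability.Probability"
begin

text \<open>
  A locally finite rooted tree is encoded by Ulam-Harris labels: vertices are words over the
  naturals, the root is the empty word, and \<open>T v\<close> is the number of children of \<open>v\<close>,
  which are \<open>v @ [0], \<dots>, v @ [T v - 1]\<close>. Values of \<open>T\<close> at words that are not vertices
  are irrelevant.
\<close>

type_synonym tree = "nat list \<Rightarrow> nat"

definition verts :: "tree \<Rightarrow> nat list set" where
  "verts T = {v. \<forall>m < length v. v ! m < T (take m v)}"

definition level :: "tree \<Rightarrow> nat \<Rightarrow> nat list set" where
  "level T n = {v \<in> verts T. length v = n}"

text \<open>
  In the Galton-Watson tree the offspring numbers of all words are i.i.d.; those attached to words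
  that are not vertices are never looked at.
\<close>

definition gw_tree :: "nat pmf \<Rightarrow> tree measure" where
  "gw_tree \<xi> = (\<Pi>\<^sub>M v\<in>UNIV. measure_pmf \<xi>)"

definition regular_tree :: "nat \<Rightarrow> tree measure" where
  "regular_tree d = return (\<Pi>\<^sub>M v\<in>UNIV. count_space UNIV) (\<lambda>_. d)"

text \<open>
  \<open>colouring k T n\<close> is the law of the \<open>k\<close>-colouring model on the first \<open>n\<close> levels of \<open>T\<close>
  (configurations are \<open>undefined\<close> elsewhere). The parent of a nonempty word \<open>v\<close> is
  \<open>butlast v\<close>. The sets \<open>level T n\<close> are finite, as \<^const>\<open>Pi_pmf\<close> requires, and the
  colour sets are nonempty for \<open>k \<ge> 2\<close>.
\<close>

primrec colouring :: "nat \<Rightarrow> tree \<Rightarrow> nat \<Rightarrow> (nat list \<Rightarrow> nat) pmf" where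
  "colouring k T 0 = map_pmf (\<lambda>s. (\<lambda>_. undefined)([] := s)) (pmf_of_set {1..k})"
| "colouring k T (Suc n) =
     bind_pmf (colouring k T n) (\<lambda>\<sigma>.
       map_pmf (\<lambda>\<tau>. override_on \<sigma> \<tau> (level T (Suc n)))
         (Pi_pmf (level T (Suc n)) undefined
           (\<lambda>v. pmf_of_set ({1..k} - {\<sigma> (butlast v)}))))"

text \<open>The conditional law of the colours at level \<open>n\<close>, given \<open>T\<close> and root colour \<open>i\<close>.\<close>

definition level_law :: "nat \<Rightarrow> tree \<Rightarrow> nat \<Rightarrow> nat \<Rightarrow> (nat list \<Rightarrow> nat) pmf" where
  "level_law k T n i =
     map_pmf (\<lambda>\<sigma>. restrict \<sigma> (level T n)) (cond_pmf (colouring k T n) {\<sigma>. \<sigma> [] = i})"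

definition tv_dist :: "'a pmf \<Rightarrow> 'a pmf \<Rightarrow> real" where
  "tv_dist p q = (SUP A. \<bar>measure_pmf.prob p A - measure_pmf.prob q A\<bar>)"

text \<open>
  The integrand below depends only on the first \<open>n\<close> levels of \<open>T\<close>, of which there are countably
  many, and lies in \<open>[0, 1]\<close>; so it is integrable for any law of \<open>T\<close> on the product space.
  The limit superior is taken in \<^typ>\<open>ereal\<close> since \<^typ>\<open>real\<close> is not a complete lattice.
\<close>

definition reconstructible :: "nat \<Rightarrow> tree measure \<Rightarrow> bool" where
  "reconstructible k M \<longleftrightarrow>
     (\<exists>i\<in>{1..k}. \<exists>j\<in>{1..k}.
        limsup (\<lambda>n. ereal (\<integral>T. tv_dist (level_law k T n i) (level_law k T n j) \<partial>M)) > 0)"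

end

theory Submission
  imports Defs "HOL-Combinatorics.Permutations" "HOL-Real_Asymp.Real_Asymp"
begin

text \<open>
  Given the colours at level \<open>n\<close>, let \<open>\<eta>\<close> be the posterior of the root colour. The order
  parameter is \<open>x\<^sub>n = E (\<Sum>\<^sub>l sqrt (1 - \<eta>\<^sub>l) - (k - 1))\<close>, which vanishes iff the root colour is
  determined. The Bhattacharyya coefficient of the laws of the level given two root colours
  is multiplicative over the subtrees of the root, so at level \<open>n + 1\<close> it is the offspring
  generating function at \<open>B \<approx> 1 - (1 - 2 x\<^sub>n) / k\<close>, hence at most \<open>exp (- (d / k) (1 - 2 x\<^sub>n))\<close>
  up to lower-order terms. Conversely, for a probability vector with two nonzero entries
  \<open>a\<^sup>2, b\<^sup>2\<close> the loss is \<open>a + b - 1 = a b - (1 - a) (1 - b)\<close>, so \<open>x\<close> is at most \<open>(k - 1) / 2\<close>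
  times the Bhattacharyya coefficient, and by a constant factor less unless likelihood ratios
  are almost always extreme. Without that factor, \<open>y = 2 x ln k\<close> satisfies \<open>y' \<le> exp (y - \<beta>)\<close>,
  which preserves \<open>y \<le> 1\<close> exactly when \<open>\<beta> \<ge> 1\<close> (the freezing threshold). The constant factor
  is gained because, with probability bounded below under the tilted measure, no child of the
  root has a posterior above \<open>1/2\<close> at either of the two colours; hence \<open>y \<le> 1\<close> persists for some
  \<open>\<beta> < 1\<close>.
\<close>

section \<open>The loss of a nonnegative vector\<close>

text \<open>The square roots in the order parameter are what closes the recursion. A child of a
  vertex coloured \<open>i\<close> takes any other colour uniformly, so its observation has density
  proportional to \<open>S - p i\<close>, and \<open>sqrt ((S - p i) * (S - p j))\<close> expands
  into \<open>S\<close>, minus one drop for each of the two colours, plus a small cross term.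
  Symmetry between the colours expresses the mean drop through the mean loss alone, so one scalar
  determines the Bhattacharyya coefficient to leading order. The loss is made homogeneous of degree
  one so that it applies to likelihood vectors: summed over observations and divided by
  \<open>k\<close>, it is the mean loss of the posterior for a uniform root colour. Two obstacles
  shape the rest. The constant factor is gained only while \<open>d * x / k\<close> stays bounded,
  so large \<open>d\<close> is treated apart, where the bound without the gain suffices. And the
  model is defined for a fixed tree while the recursion concerns the joint law of tree and colours;
  testing total variation on one event and averaging over the tree links the two.\<close>

definition loss :: "'a set \<Rightarrow> ('a \<Rightarrow> real) \<Rightarrow> real" where
  "loss K r = (\<Sum>l\<in>K. sqrt (sum r K * (sum r K - r l))) - (real (card K) - 1) * sum r K"

lemma sqrt_deficit: "0 \<le> x \<Longrightarrow> x \<le> 1 \<Longrightarrow> 1 - sqrt (1 - x) = x / (1 + sqrt (1 - x))" for x :: real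
proof -
  assume x: "0 \<le> x" "x \<le> 1"
  have "(1 - sqrt (1 - x)) * (1 + sqrt (1 - x)) = x"
    using x by (simp add: algebra_simps)
  moreover have "1 + sqrt (1 - x) > 0" using x by (simp add: add_pos_nonneg)
  ultimately show ?thesis by (simp add: field_simps)
qed

lemma half_le_sqrt_deficit: "0 \<le> x \<Longrightarrow> x \<le> 1 \<Longrightarrow> x / 2 \<le> 1 - sqrt (1 - x)" for x :: real
  unfolding sqrt_deficit by (intro divide_left_mono) (auto intro!: add_pos_nonneg mult_pos_pos)

lemma sqrt_deficit_le: "0 \<le> x \<Longrightarrow> x \<le> 1 \<Longrightarrow> 1 - sqrt (1 - x) \<le> x" for x :: real
proof -
  assume x: "0 \<le> x" "x \<le> 1"
  have "1 - x \<le> sqrt (1 - x)" using x by (intro real_le_rsqrt) (auto simp: power2_eq_square mult_left_le_one_le)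
  then show ?thesis by simp
qed

lemma sqrt_sum_le_sum_sqrt:
  assumes "finite A" "\<And>i. i \<in> A \<Longrightarrow> 0 \<le> f i"
  shows "sqrt (\<Sum>i\<in>A. f i) \<le> (\<Sum>i\<in>A. sqrt (f i))"
  using assms
proof (induction A rule: finite_induct)
  case (insert x A)
  have "sqrt (f x + sum f A) \<le> sqrt (f x) + sqrt (sum f A)"
    using insert by (intro sqrt_add_le_add_sqrt sum_nonneg) auto
  with insert show ?case by simp
qed simp

lemma harmonic_le_sqrt:
  fixes a b :: real
  assumes "0 \<le> a" "0 \<le> b"
  shows "a * b / (a + b) \<le> sqrt (a * b) / 2"
proof (cases "a * b = 0")
  case False
  then have ab: "a > 0" "b > 0" using assms by auto
  have "2 * sqrt (a * b) \<le> a + b" using arith_geo_mean_sqrt[of a b] assms by simp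
  then have "sqrt (a * b) * (2 * sqrt (a * b)) \<le> sqrt (a * b) * (a + b)" using ab by (intro mult_left_mono) auto
  then have "2 * (a * b) \<le> sqrt (a * b) * (a + b)" using ab by (simp add: mult.left_commute)
  then show ?thesis using ab by (simp add: field_simps)
qed auto

locale prob_vector =
  fixes K :: "'a set" and \<eta> :: "'a \<Rightarrow> real" and m :: 'a
  assumes fin: "finite K" and nonneg: "l \<in> K \<Longrightarrow> 0 \<le> \<eta> l" and sum1: "sum \<eta> K = 1"
    and mK: "m \<in> K" and max: "l \<in> K \<Longrightarrow> \<eta> l \<le> \<eta> m"
begin

text \<open>Error probability of guessing the most likely colour. The loss is comparable to its
  square root, and the estimates below go through this comparison.\<close>

definition q where "q = 1 - \<eta> m"

lemma le1: "l \<in> K \<Longrightarrow> \<eta> l \<le> 1"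
  using member_le_sum[of l K \<eta>] fin nonneg sum1 by auto

lemma q: "0 \<le> q" "q \<le> 1" "sum \<eta> (K - {m}) = q"
  using le1[OF mK] nonneg[OF mK] sum.remove[OF fin mK, of \<eta>] sum1 by (auto simp: q_def)

lemma q_le_sqrt: "q \<le> sqrt q"
  using q by (intro real_le_rsqrt) (auto simp: power2_eq_square mult_left_le_one_le)

lemma loss_eq: "loss K \<eta> = 1 - (\<Sum>l\<in>K. 1 - sqrt (1 - \<eta> l))"
  unfolding loss_def sum1 by (simp add: sum_subtractf)

text \<open>Every \<open>1 - \<eta> l\<close> is at least \<open>q\<close>, so each deficit is at
  most \<open>\<eta> l / (1 + sqrt q)\<close>, and these sum to
  \<open>1 / (1 + sqrt q)\<close>.\<close>

lemma loss_ge: "sqrt q / 2 \<le> loss K \<eta>"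
proof -
  have "(\<Sum>l\<in>K. 1 - sqrt (1 - \<eta> l)) \<le> (\<Sum>l\<in>K. \<eta> l / (1 + sqrt q))"
  proof (rule sum_mono)
    fix l assume l: "l \<in> K"
    have "sqrt q \<le> sqrt (1 - \<eta> l)" using max[OF l] by (simp add: q_def)
    then show "1 - sqrt (1 - \<eta> l) \<le> \<eta> l / (1 + sqrt q)"
      unfolding sqrt_deficit[OF nonneg[OF l] le1[OF l]]
      using nonneg[OF l] le1[OF l] q by (intro divide_left_mono) (auto intro!: mult_pos_pos add_pos_nonneg)
  qed
  also have "\<dots> = 1 / (1 + sqrt q)" by (simp add: sum_divide_distrib[symmetric] sum1)
  finally have "1 - 1 / (1 + sqrt q) \<le> loss K \<eta>" unfolding loss_eq by simp
  moreover have "1 - 1 / (1 + sqrt q) = sqrt q / (1 + sqrt q)" using q by (simp add: field_simps add_nonneg_eq_0_iff)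
  moreover have "sqrt q / 2 \<le> sqrt q / (1 + sqrt q)" using q by (intro divide_left_mono) (auto intro!: add_pos_nonneg)
  ultimately show ?thesis by linarith
qed

lemma loss_le: "loss K \<eta> \<le> sqrt q - q / 2"
proof -
  have "(\<Sum>l\<in>K. 1 - sqrt (1 - \<eta> l)) = 1 - sqrt q + (\<Sum>l\<in>K-{m}. 1 - sqrt (1 - \<eta> l))"
    using sum.remove[OF fin mK, of "\<lambda>l. 1 - sqrt (1 - \<eta> l)"] by (simp add: q_def)
  moreover have "(\<Sum>l\<in>K-{m}. \<eta> l / 2) \<le> (\<Sum>l\<in>K-{m}. 1 - sqrt (1 - \<eta> l))"
    by (intro sum_mono half_le_sqrt_deficit) (auto simp: nonneg le1)
  moreover have "(\<Sum>l\<in>K-{m}. \<eta> l / 2) = q / 2" by (simp add: sum_divide_distrib[symmetric] q)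
  ultimately show ?thesis unfolding loss_eq by linarith
qed

text \<open>Only the largest entry contributes at order \<open>sqrt q\<close>; the others have total
  mass \<open>q\<close>.\<close>

lemma sum_weighted_le: "(\<Sum>l\<in>K. \<eta> l * sqrt (1 - \<eta> l)) \<le> 4 * loss K \<eta>"
proof -
  have "(\<Sum>l\<in>K. \<eta> l * sqrt (1 - \<eta> l)) = \<eta> m * sqrt q + (\<Sum>l\<in>K-{m}. \<eta> l * sqrt (1 - \<eta> l))"
    using sum.remove[OF fin mK, of "\<lambda>l. \<eta> l * sqrt (1 - \<eta> l)"] by (simp add: q_def)
  also have "\<dots> \<le> 1 * sqrt q + (\<Sum>l\<in>K-{m}. \<eta> l * 1)"
    by (intro add_mono mult_mono sum_mono) (auto simp: nonneg le1 mK q)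
  also have "\<dots> \<le> 2 * sqrt q" using q q_le_sqrt by simp
  also have "\<dots> \<le> 4 * loss K \<eta>" using loss_ge by simp
  finally show ?thesis .
qed

lemma sum_pairs_deficit_le:
  "(\<Sum>i\<in>K. \<Sum>j\<in>K-{i}. (1 - sqrt (1 - \<eta> i)) * (1 - sqrt (1 - \<eta> j))) \<le> 4 * loss K \<eta>"
proof -
  have "(\<Sum>i\<in>K. \<Sum>j\<in>K-{i}. (1 - sqrt (1 - \<eta> i)) * (1 - sqrt (1 - \<eta> j)))
      \<le> (\<Sum>i\<in>K. \<Sum>j\<in>K-{i}. \<eta> i * \<eta> j)"
    by (intro sum_mono mult_mono sqrt_deficit_le) (auto simp: nonneg le1)
  also have "\<dots> = (\<Sum>i\<in>K. \<eta> i * (1 - \<eta> i))"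
    by (intro sum.cong refl) (use fin sum1 in \<open>simp add: sum_distrib_left[symmetric] sum_diff1\<close>)
  also have "\<dots> = \<eta> m * (1 - \<eta> m) + (\<Sum>i\<in>K-{m}. \<eta> i * (1 - \<eta> i))"
    by (rule sum.remove[OF fin mK])
  also have "\<dots> \<le> 1 * q + (\<Sum>l\<in>K-{m}. \<eta> l * 1)"
    unfolding q_def by (intro add_mono mult_mono sum_mono) (auto simp: nonneg le1 mK q)
  also have "\<dots> \<le> 2 * sqrt q" using q q_le_sqrt by simp
  also have "\<dots> \<le> 4 * loss K \<eta>" using loss_ge by simp
  finally show ?thesis .
qed

text \<open>For two entries \<open>a^2\<close>, \<open>b^2\<close> the loss falls short of
  \<open>a * b\<close> by \<open>(1 - a) * (1 - b)\<close>, which has the order of the harmonic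
  term. This slack pays for the subtracted twentieth; the small constant leaves room for vectors
  with many entries. When one entry dominates, the pairs containing it suffice; otherwise the square
  of the sum of the roots is large.\<close>

lemma loss_le_pairs:
  "2 * loss K \<eta> \<le> (\<Sum>i\<in>K. \<Sum>j\<in>K-{i}. sqrt (\<eta> i * \<eta> j) - \<eta> i * \<eta> j / (\<eta> i + \<eta> j) / 20)"
proof -
  define g where "g i j = sqrt (\<eta> i * \<eta> j) - \<eta> i * \<eta> j / (\<eta> i + \<eta> j) / 20" for i j
  have g39: "g i j \<ge> 39 / 40 * sqrt (\<eta> i * \<eta> j)" if "i \<in> K" "j \<in> K" for i j
  proof -
    define h where "h = \<eta> i * \<eta> j / (\<eta> i + \<eta> j)"
    have "h \<le> sqrt (\<eta> i * \<eta> j) / 2"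
      using harmonic_le_sqrt[OF nonneg[OF that(1)] nonneg[OF that(2)]] by (simp only: h_def)
    then show ?thesis unfolding g_def h_def[symmetric] by linarith
  qed
  then have g0: "g i j \<ge> 0" if "i \<in> K" "j \<in> K" for i j
    using that nonneg by (intro order.trans[OF _ g39]) auto
  have "2 * loss K \<eta> \<le> (\<Sum>i\<in>K. \<Sum>j\<in>K-{i}. g i j)"
  proof (cases "q \<le> 1/2")
    case True
    have gm: "g i j \<ge> sqrt (\<eta> i * \<eta> j) - \<eta> j / 20" if "i \<in> K" "j \<in> K" for i j
    proof -
      have "\<eta> i * \<eta> j / (\<eta> i + \<eta> j) \<le> \<eta> j"
        using nonneg[OF that(1)] nonneg[OF that(2)]
        by (cases "\<eta> i + \<eta> j = 0") (auto simp: divide_le_eq algebra_simps)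
      then show ?thesis unfolding g_def by (intro diff_left_mono divide_right_mono) auto
    qed
    define A where "A = (\<Sum>j\<in>K-{m}. sqrt (\<eta> m * \<eta> j) - \<eta> j / 20)"
    have A: "A \<ge> sqrt (1 - q) * sqrt q - q / 20"
    proof -
      have "A = sqrt (\<eta> m) * (\<Sum>j\<in>K-{m}. sqrt (\<eta> j)) - q / 20"
        unfolding A_def by (simp add: sum_subtractf real_sqrt_mult sum_distrib_left sum_divide_distrib[symmetric] q)
      moreover have "sqrt q \<le> (\<Sum>j\<in>K-{m}. sqrt (\<eta> j))"
        unfolding q(3)[symmetric] using fin nonneg by (intro sqrt_sum_le_sum_sqrt) auto
      then have "sqrt (\<eta> m) * sqrt q \<le> sqrt (\<eta> m) * (\<Sum>j\<in>K-{m}. sqrt (\<eta> j))"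
        using nonneg[OF mK] by (intro mult_left_mono) auto
      ultimately show ?thesis by (simp add: q_def)
    qed
    have "(\<Sum>i\<in>K. \<Sum>j\<in>K-{i}. g i j) = (\<Sum>j\<in>K-{m}. g m j) + (\<Sum>i\<in>K-{m}. \<Sum>j\<in>K-{i}. g i j)"
      by (rule sum.remove[OF fin mK])
    moreover have "(\<Sum>j\<in>K-{m}. g m j) \<ge> A"
      unfolding A_def by (intro sum_mono gm) (auto simp: mK)
    \<comment> \<open>Every row other than \<open>m\<close> is cut down to its entry at
      \<open>m\<close>, so each pair containing \<open>m\<close> is counted in both orders.\<close>
    moreover have "(\<Sum>i\<in>K-{m}. \<Sum>j\<in>K-{i}. g i j) \<ge> (\<Sum>i\<in>K-{m}. g i m)"
      using fin g0 mK by (intro sum_mono member_le_sum) auto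
    moreover have "(\<Sum>i\<in>K-{m}. g i m) = (\<Sum>j\<in>K-{m}. g m j)"
      by (intro sum.cong refl) (simp add: g_def mult.commute add.commute)
    ultimately have "2 * A \<le> (\<Sum>i\<in>K. \<Sum>j\<in>K-{i}. g i j)"
      by linarith
    then have "2 * (sqrt (1 - q) * sqrt q - q / 20) \<le> (\<Sum>i\<in>K. \<Sum>j\<in>K-{i}. g i j)"
      using A by (intro order.trans[OF mult_left_mono[OF A]]) auto
    \<comment> \<open>In terms of \<open>s\<close> and \<open>t\<close> the claim is
      \<open>1 - t \<le> 9/20 * s\<close>, where \<open>9/20 = 1/2 - 1/20\<close>. The numbers
      71/100 and 7/10 enclose \<open>sqrt (1/2)\<close>, the extreme value of both roots for
      \<open>q \<le> 1/2\<close>, and they give the constant 71/170, which is below 9/20.\<close>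
    moreover have "sqrt q - q / 2 \<le> sqrt (1 - q) * sqrt q - q / 20"
    proof -
      define s t where "s = sqrt q" and "t = sqrt (1 - q)"
      have s: "s \<ge> 0" "s\<^sup>2 = q" and t: "t \<ge> 0" "t\<^sup>2 = 1 - q" using q by (auto simp: s_def t_def)
      have s': "s \<le> 71/100" by (rule power2_le_imp_le, unfold s(2)) (use True in \<open>simp_all add: power2_eq_square\<close>)
      have t': "t \<ge> 7/10" by (rule power2_le_imp_le, unfold t(2)) (use True t in \<open>simp_all add: power2_eq_square\<close>)
      have "(1 - t) * (1 + t) = s * s" using s t by (simp add: power2_eq_square algebra_simps)
      also have "\<dots> \<le> s * (71/100)" using s s' by (intro mult_left_mono)
      finally have "(1 - t) * (1 + t) \<le> s * (71/100)" .
      moreover have "(1 - t) * (17/10) \<le> (1 - t) * (1 + t)"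
        using t t' q by (intro mult_left_mono) (auto simp: t_def)
      ultimately have "(1 - t) * (17/10) \<le> s * (71/100)" by (rule order.trans[rotated])
      then have "1 - t \<le> 9/20 * s" using s(1) by (simp add: field_simps)
      then have "s * (1 - t) \<le> s * (9/20 * s)" using s by (intro mult_left_mono)
      then show ?thesis using s unfolding s_def[symmetric] t_def[symmetric]
        by (simp add: power2_eq_square algebra_simps)
    qed
    ultimately show ?thesis using loss_le by (meson mult_left_mono order.trans zero_le_numeral)
  next
    case False
    have pos: "\<eta> m > 0"
    proof (rule ccontr)
      assume "\<not> \<eta> m > 0"
      then have "\<eta> l = 0" if "l \<in> K" for l using max[OF that] nonneg[OF that] by simp
      then show False using sum1 by simp
    qed
    have half: "\<eta> m \<le> 1/2" using False by (simp add: q_def)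
    \<comment> \<open>Squaring this sum produces the pairs and a diagonal of total 1, so the pairs
      retain \<open>1 / \<eta> m - 1\<close>.\<close>
    have s: "(\<Sum>i\<in>K. sqrt (\<eta> i)) \<ge> 1 / sqrt (\<eta> m)"
    proof -
      have "1 / sqrt (\<eta> m) = (\<Sum>i\<in>K. \<eta> i / sqrt (\<eta> m))" by (simp add: sum_divide_distrib[symmetric] sum1)
      also have "\<dots> \<le> (\<Sum>i\<in>K. sqrt (\<eta> i))"
      proof (rule sum_mono)
        fix i assume i: "i \<in> K"
        have "sqrt (\<eta> i) * sqrt (\<eta> i) \<le> sqrt (\<eta> i) * sqrt (\<eta> m)"
          using max[OF i] nonneg[OF i] by (intro mult_left_mono) auto
        then show "\<eta> i / sqrt (\<eta> m) \<le> sqrt (\<eta> i)" using pos nonneg[OF i] by (simp add: field_simps)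
      qed
      finally show ?thesis .
    qed
    have "(1 / sqrt (\<eta> m)) * (1 / sqrt (\<eta> m)) \<le> (\<Sum>i\<in>K. sqrt (\<eta> i)) * (\<Sum>i\<in>K. sqrt (\<eta> i))"
      using s pos by (intro mult_mono) (auto intro!: sum_nonneg simp: nonneg)
    then have sq: "1 / \<eta> m \<le> (\<Sum>i\<in>K. sqrt (\<eta> i)) * (\<Sum>i\<in>K. sqrt (\<eta> i))" using pos by simp
    also have "\<dots> = (\<Sum>i\<in>K. \<Sum>j\<in>K. sqrt (\<eta> i * \<eta> j))" by (simp add: sum_product real_sqrt_mult)
    also have "\<dots> = (\<Sum>i\<in>K. \<eta> i + (\<Sum>j\<in>K-{i}. sqrt (\<eta> i * \<eta> j)))"
      by (intro sum.cong refl) (subst sum.remove[OF fin], auto simp: nonneg)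
    also have "\<dots> = 1 + (\<Sum>i\<in>K. \<Sum>j\<in>K-{i}. sqrt (\<eta> i * \<eta> j))" by (simp add: sum.distrib sum1)
    finally have "1 / \<eta> m - 1 \<le> (\<Sum>i\<in>K. \<Sum>j\<in>K-{i}. sqrt (\<eta> i * \<eta> j))" by simp
    then have "39 / 40 * (1 / \<eta> m - 1) \<le> 39 / 40 * (\<Sum>i\<in>K. \<Sum>j\<in>K-{i}. sqrt (\<eta> i * \<eta> j))" by simp
    also have "\<dots> \<le> (\<Sum>i\<in>K. \<Sum>j\<in>K-{i}. g i j)"
      unfolding sum_distrib_left by (intro sum_mono g39) auto
    finally have 1: "39 / 40 * (1 / \<eta> m - 1) \<le> (\<Sum>i\<in>K. \<Sum>j\<in>K-{i}. g i j)" .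
    have "1 / \<eta> m - 1 = q / \<eta> m" using pos by (simp add: q_def field_simps)
    moreover have "q / \<eta> m \<ge> q / (1/2)" using pos half q by (intro divide_left_mono) auto
    ultimately have "1 / \<eta> m - 1 \<ge> 2 * q" by simp
    moreover have "2 * (sqrt q - q / 2) \<le> 39 / 40 * (2 * q)"
    proof -
      \<comment> \<open>The tangent to the square root at \<open>q = 49/100\<close>, next to the end
        of the range \<open>q > 1/2\<close>, where the inequality is tightest.\<close>
      have "0 \<le> (sqrt q - 7/10)\<^sup>2" by simp
      then have "sqrt q \<le> q / (14/10) + 35/100" using q by (simp add: power2_diff field_simps)
      then show ?thesis using False by (simp add: field_simps)
    qed
    moreover have "39 / 40 * (2 * q) \<le> 39 / 40 * (1 / \<eta> m - 1)"
      using calculation(1) by (intro mult_left_mono) auto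
    ultimately have "2 * (sqrt q - q / 2) \<le> (\<Sum>i\<in>K. \<Sum>j\<in>K-{i}. g i j)"
      using 1 by (meson order.trans)
    then show ?thesis using loss_le by (meson mult_left_mono order.trans zero_le_numeral)
  qed
  then show ?thesis unfolding g_def .
qed

end

lemma loss_scale:
  assumes "c \<ge> 0" shows "loss K (\<lambda>l. c * r l) = c * loss K r"
proof -
  have "sqrt (c * sum r K * (c * sum r K - c * r l)) = c * sqrt (sum r K * (sum r K - r l))" for l
  proof -
    have "c * sum r K * (c * sum r K - c * r l) = c\<^sup>2 * (sum r K * (sum r K - r l))"
      by (simp only: power2_eq_square) algebra
    then show ?thesis using assms by (simp only: real_sqrt_mult real_sqrt_abs abs_of_nonneg)
  qed
  then show ?thesis
    unfolding loss_def sum_distrib_left[symmetric] by (simp add: sum_distrib_left[symmetric] right_diff_distrib mult.left_commute)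
qed

lemma loss_zero: "finite K \<Longrightarrow> (\<And>l. l \<in> K \<Longrightarrow> 0 \<le> r l) \<Longrightarrow> sum r K = 0 \<Longrightarrow> loss K r = 0"
  unfolding loss_def by simp

locale nonneg_vector =
  fixes K :: "'a set" and r :: "'a \<Rightarrow> real"
  assumes fin: "finite K" and nonneg: "l \<in> K \<Longrightarrow> 0 \<le> r l"
begin

abbreviation "S \<equiv> sum r K"

lemma S_nonneg: "0 \<le> S" by (intro sum_nonneg nonneg)

lemma le_S: "l \<in> K \<Longrightarrow> r l \<le> S"
  using member_le_sum[of l K r] fin nonneg by auto

text \<open>Homogeneity reduces inequalities about the loss to probability vectors. The zero vector,
  an observation that no colour can produce, has no normalisation and is split off.\<close>

lemma normalize_cases:
  obtains "S = 0" "\<And>l. l \<in> K \<Longrightarrow> r l = 0" "loss K r = 0"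
  | m where "S > 0" "prob_vector K (\<lambda>l. r l / S) m" "loss K r = S * loss K (\<lambda>l. r l / S)"
proof (cases "S = 0")
  case True
  then show thesis using that(1) loss_zero[of K r] fin nonneg by (simp add: sum_nonneg_eq_0_iff)
next
  case False
  then have pos: "S > 0" using S_nonneg by simp
  then have "K \<noteq> {}" by auto
  then have "Max (r ` K) \<in> r ` K" using fin by simp
  then obtain m where m: "m \<in> K" "r m = Max (r ` K)" by auto
  then have "r l \<le> r m" if "l \<in> K" for l using fin that by simp
  then have "prob_vector K (\<lambda>l. r l / S) m"
    using pos m fin nonneg by unfold_locales (auto simp: sum_divide_distrib[symmetric] divide_right_mono)
  moreover have "loss K r = S * loss K (\<lambda>l. r l / S)"
    using loss_scale[of S K "\<lambda>l. r l / S"] pos by simp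
  ultimately show thesis using pos that(2) by blast
qed

lemma loss_nonneg: "0 \<le> loss K r"
proof (cases rule: normalize_cases)
  case (2 m)
  interpret prob_vector K "\<lambda>l. r l / S" m by fact
  have "0 \<le> loss K (\<lambda>l. r l / S)" using q by (intro order.trans[OF _ loss_ge]) simp
  then show ?thesis using 2(1,3) by simp
qed simp

lemma sqrt_mult_diff:
  assumes "S > 0" "l \<in> K" shows "sqrt (S * (S - r l)) = S * sqrt (1 - r l / S)"
proof -
  have "S * (S - r l) = S\<^sup>2 * (1 - r l / S)" using assms by (simp add: power2_eq_square field_simps)
  then show ?thesis using assms by (simp add: real_sqrt_mult)
qed

lemma sum_weighted_le: "(\<Sum>l\<in>K. r l * sqrt (1 - r l / S)) \<le> 4 * loss K r"
proof (cases rule: normalize_cases)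
  case (2 m)
  interpret prob_vector K "\<lambda>l. r l / S" m by fact
  have "(\<Sum>l\<in>K. r l * sqrt (1 - r l / S)) = S * (\<Sum>l\<in>K. r l / S * sqrt (1 - r l / S))"
    using 2(1) by (simp add: sum_distrib_left)
  also have "\<dots> \<le> S * (4 * loss K (\<lambda>l. r l / S))" using sum_weighted_le 2(1) by (intro mult_left_mono) auto
  finally show ?thesis using 2 by simp
qed simp

text \<open>Chosen so that \<open>sqrt (S - r l) = sqrt S - u l\<close>: the geometric mean of two
  such masses then splits into terms linear in \<open>u\<close>, whose sum over the colours is fixed
  by the loss, and one product \<open>u i * u j\<close>.\<close>

definition u where "u l = sqrt S - sqrt (S - r l)"

lemma u_eq: "S > 0 \<Longrightarrow> l \<in> K \<Longrightarrow> u l = sqrt S * (1 - sqrt (1 - r l / S))"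
proof -
  assume "S > 0" "l \<in> K"
  then have "S - r l = S * (1 - r l / S)" by (simp add: field_simps)
  then show ?thesis unfolding u_def by (metis mult.right_neutral real_sqrt_mult right_diff_distrib')
qed

lemma sum_pairs_u_le: "(\<Sum>i\<in>K. \<Sum>j\<in>K-{i}. u i * u j) \<le> 4 * loss K r"
proof (cases rule: normalize_cases)
  case 1
  then show ?thesis by (simp add: u_def)
next
  case (2 m)
  interpret prob_vector K "\<lambda>l. r l / S" m by fact
  have "u i * u j = S * ((1 - sqrt (1 - r i / S)) * (1 - sqrt (1 - r j / S)))" if "i \<in> K" "j \<in> K" for i j
    using 2(1) that by (simp add: u_eq)
  then have "(\<Sum>i\<in>K. \<Sum>j\<in>K-{i}. u i * u j) = S * (\<Sum>i\<in>K. \<Sum>j\<in>K-{i}. (1 - sqrt (1 - r i / S)) * (1 - sqrt (1 - r j / S)))"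
    unfolding sum_distrib_left by (intro sum.cong refl) auto
  also have "\<dots> \<le> S * (4 * loss K (\<lambda>l. r l / S))" using sum_pairs_deficit_le 2(1) by (intro mult_left_mono) auto
  finally show ?thesis using 2 by simp
qed

lemma sum_u: "(\<Sum>l\<in>K. sqrt S * u l) = S - loss K r"
proof -
  have "sqrt S * u l = S - sqrt (S * (S - r l))" for l
    using S_nonneg unfolding u_def right_diff_distrib[of "sqrt S"] real_sqrt_mult by simp
  then have "(\<Sum>l\<in>K. sqrt S * u l) = (\<Sum>l\<in>K. S - sqrt (S * (S - r l)))" by simp
  also have "\<dots> = S - loss K r" unfolding loss_def sum_subtractf by (simp add: left_diff_distrib)
  finally show ?thesis .
qed

lemma sqrt_pair_eq:
  assumes "i \<in> K" "j \<in> K"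
  shows "sqrt ((S - r i) * (S - r j)) = S - sqrt S * u i - sqrt S * u j + u i * u j"
proof -
  have "S = sqrt S * sqrt S" using S_nonneg by simp
  then show ?thesis unfolding u_def real_sqrt_mult by algebra
qed

lemma loss_le_pairs:
  "2 * loss K r \<le> (\<Sum>i\<in>K. \<Sum>j\<in>K-{i}. sqrt (r i * r j) - r i * r j / (r i + r j) / 20)"
proof (cases rule: normalize_cases)
  case (2 m)
  interpret prob_vector K "\<lambda>l. r l / S" m by fact
  have *: "sqrt (r i * r j) - r i * r j / (r i + r j) / 20
       = S * (sqrt (r i / S * (r j / S)) - r i / S * (r j / S) / (r i / S + r j / S) / 20)" if "i \<in> K" "j \<in> K" for i j
    using 2(1) by (simp add: real_sqrt_mult real_sqrt_divide right_diff_distrib add_divide_distrib[symmetric])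
  have "2 * loss K r = S * (2 * loss K (\<lambda>l. r l / S))" using 2 by simp
  also have "\<dots> \<le> S * (\<Sum>i\<in>K. \<Sum>j\<in>K-{i}. sqrt (r i / S * (r j / S)) - r i / S * (r j / S) / (r i / S + r j / S) / 20)"
    using loss_le_pairs 2(1) by (intro mult_left_mono) auto
  also have "\<dots> = (\<Sum>i\<in>K. \<Sum>j\<in>K-{i}. sqrt (r i * r j) - r i * r j / (r i + r j) / 20)"
    unfolding sum_distrib_left by (intro sum.cong refl *[symmetric]) auto
  finally show ?thesis .
qed simp

end

section \<open>Generating functions and sums over lists\<close>

definition pgf :: "nat pmf \<Rightarrow> real \<Rightarrow> real" where
  "pgf \<xi> s = measure_pmf.expectation \<xi> (\<lambda>n. s ^ n)"

lemma integrable_pgf: "0 \<le> s \<Longrightarrow> s \<le> 1 \<Longrightarrow> integrable (measure_pmf \<xi>) (\<lambda>n. s ^ n)" for s :: real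
  by (rule measure_pmf.integrable_const_bound[where B = 1]) (auto simp: power_le_one)

lemma pgf_nonneg: "0 \<le> s \<Longrightarrow> 0 \<le> pgf \<xi> s"
  unfolding pgf_def by (intro Bochner_Integration.integral_nonneg) auto

lemma pgf_mono: "0 \<le> s \<Longrightarrow> s \<le> t \<Longrightarrow> t \<le> 1 \<Longrightarrow> pgf \<xi> s \<le> pgf \<xi> t"
  unfolding pgf_def by (intro integral_mono integrable_pgf power_mono) auto

lemma nn_integral_lists_of_length:
  fixes w :: "'a \<Rightarrow> ennreal"
  shows "(\<integral>\<^sup>+ os. (if length os = n then prod_list (map w os) else 0) \<partial>count_space UNIV)
           = (\<integral>\<^sup>+ x. w x \<partial>count_space UNIV) ^ n"
proof (induction n)
  case 0
  have "(\<lambda>os. if length os = 0 then prod_list (map w os) else 0) = indicator {[]}"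
    by (auto simp: fun_eq_iff indicator_def)
  then show ?case by simp
next
  case (Suc n)
  let ?F = "\<lambda>n os. if length os = n then prod_list (map w os) else 0"
  have bij: "bij_betw (\<lambda>(x, xs). x # xs) UNIV {os. os \<noteq> []}"
    by (rule bij_betwI[where g = "\<lambda>os. (hd os, tl os)"]) auto
  have "(\<integral>\<^sup>+ os. ?F (Suc n) os \<partial>count_space UNIV) = (\<integral>\<^sup>+ os. ?F (Suc n) os \<partial>count_space {os. os \<noteq> []})"
    by (intro nn_integral_count_space_eq) auto
  also have "\<dots> = (\<integral>\<^sup>+ y. ?F (Suc n) (case y of (x, xs) \<Rightarrow> x # xs) \<partial>count_space UNIV)"
    by (rule nn_integral_bij_count_space[OF bij, symmetric])
  also have "\<dots> = (\<integral>\<^sup>+ x. \<integral>\<^sup>+ xs. ?F (Suc n) (case (x, xs) of (x, xs) \<Rightarrow> x # xs) \<partial>count_space UNIV \<partial>count_space UNIV)"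
    by (rule nn_integral_fst_count_space[symmetric])
  also have "\<dots> = (\<integral>\<^sup>+ x. w x * (\<integral>\<^sup>+ xs. ?F n xs \<partial>count_space UNIV) \<partial>count_space UNIV)"
    by (subst nn_integral_cmult[symmetric]) (auto intro!: nn_integral_cong)
  also have "\<dots> = (\<integral>\<^sup>+ x. w x \<partial>count_space UNIV) * (\<integral>\<^sup>+ x. w x \<partial>count_space UNIV) ^ n"
    unfolding Suc by (rule nn_integral_multc) auto
  finally show ?case by simp
qed

lemma nn_integral_list_weights:
  fixes w :: "'a \<Rightarrow> ennreal"
  shows "(\<integral>\<^sup>+ os. ennreal (pmf \<xi> (length os)) * prod_list (map w os) \<partial>count_space UNIV)
           = (\<integral>\<^sup>+ n. (\<integral>\<^sup>+ x. w x \<partial>count_space UNIV) ^ n \<partial>measure_pmf \<xi>)"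
proof -
  let ?F = "\<lambda>n os. if length os = n then prod_list (map w os) else 0"
  have "(\<integral>\<^sup>+ os. ennreal (pmf \<xi> (length os)) * prod_list (map w os) \<partial>count_space UNIV)
      = (\<integral>\<^sup>+ os. \<integral>\<^sup>+ n. ennreal (pmf \<xi> n) * ?F n os \<partial>count_space UNIV \<partial>count_space UNIV)"
  proof (rule nn_integral_cong)
    fix os :: "'a list"
    have "(\<integral>\<^sup>+ n. ennreal (pmf \<xi> n) * ?F n os \<partial>count_space UNIV)
        = (\<integral>\<^sup>+ n. ennreal (pmf \<xi> (length os)) * prod_list (map w os) * indicator {length os} n \<partial>count_space UNIV)"
      by (intro nn_integral_cong) (auto simp: indicator_def)
    then show "ennreal (pmf \<xi> (length os)) * prod_list (map w os)
        = (\<integral>\<^sup>+ n. ennreal (pmf \<xi> n) * ?F n os \<partial>count_space UNIV)"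
      by (simp add: nn_integral_cmult_indicator)
  qed
  also have "\<dots> = (\<integral>\<^sup>+ n. \<integral>\<^sup>+ os. ennreal (pmf \<xi> n) * ?F n os \<partial>count_space UNIV \<partial>count_space UNIV)"
    by (subst nn_integral_fst_count_space[where f = "\<lambda>(os, n). ennreal (pmf \<xi> n) * ?F n os", simplified],
        subst nn_integral_snd_count_space[where f = "\<lambda>(os, n). ennreal (pmf \<xi> n) * ?F n os", symmetric, simplified]) simp
  also have "\<dots> = (\<integral>\<^sup>+ n. ennreal (pmf \<xi> n) * (\<integral>\<^sup>+ x. w x \<partial>count_space UNIV) ^ n \<partial>count_space UNIV)"
    by (intro nn_integral_cong)
       (subst nn_integral_cmult, simp, simp only: nn_integral_lists_of_length)
  also have "\<dots> = (\<integral>\<^sup>+ n. (\<integral>\<^sup>+ x. w x \<partial>count_space UNIV) ^ n \<partial>measure_pmf \<xi>)"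
    by (rule nn_integral_measure_pmf[symmetric])
  finally show ?thesis .
qed

abbreviation total :: "('a \<Rightarrow> real) \<Rightarrow> real" where
  "total f \<equiv> integral\<^sup>L (count_space UNIV) f"

text \<open>A weight that is a product over the children has as total the generating function at the
  mass of one child. The computation runs through nonnegative integrals, where sums may be
  interchanged freely, so that integrability comes out as a conclusion.\<close>

lemma total_list_weights:
  fixes w :: "'a \<Rightarrow> real"
  assumes w: "\<And>x. 0 \<le> w x" "integrable (count_space UNIV) w" and le1: "total w \<le> 1"
  shows "integrable (count_space UNIV) (\<lambda>os. pmf \<xi> (length os) * prod_list (map w os))" (is "integrable _ ?f")
    and "total (\<lambda>os. pmf \<xi> (length os) * prod_list (map w os)) = pgf \<xi> (total w)"
proof -
  have prod: "prod_list (map (\<lambda>x. ennreal (w x)) os) = ennreal (prod_list (map w os)) \<and> prod_list (map w os) \<ge> 0" for os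
    by (induction os) (auto simp: w ennreal_mult)
  have W: "(\<integral>\<^sup>+ x. ennreal (w x) \<partial>count_space UNIV) = ennreal (total w)"
    by (rule nn_integral_eq_integral) (use w in auto)
  have W0: "0 \<le> total w" by (intro Bochner_Integration.integral_nonneg w)
  have "(\<integral>\<^sup>+ os. ennreal (?f os) \<partial>count_space UNIV) = (\<integral>\<^sup>+ n. ennreal (total w) ^ n \<partial>measure_pmf \<xi>)"
    unfolding W[symmetric] nn_integral_list_weights[symmetric]
    by (intro nn_integral_cong) (use prod in \<open>simp add: ennreal_mult\<close>)
  also have "\<dots> = ennreal (pgf \<xi> (total w))"
    unfolding pgf_def ennreal_power[OF W0]
    by (rule nn_integral_eq_integral) (use W0 le1 in \<open>auto intro!: integrable_pgf\<close>)
  finally have *: "(\<integral>\<^sup>+ os. ennreal (?f os) \<partial>count_space UNIV) = ennreal (pgf \<xi> (total w))" .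
  have nn: "?f os \<ge> 0" for os using prod by simp
  show "integrable (count_space UNIV) ?f"
    by (rule integrableI_nonneg) (use nn * in auto)
  show "total ?f = pgf \<xi> (total w)"
    using * nn pgf_nonneg[OF W0] by (subst integral_eq_nn_integral) auto
qed

section \<open>One step of the recursion\<close>

lemma total_bij: "bij g \<Longrightarrow> total (\<lambda>y. f (g y)) = total f" for g :: "'a \<Rightarrow> 'b" and f :: "'b \<Rightarrow> real"
  using integral_distr[of g "count_space UNIV" "count_space UNIV" f] distr_bij_count_space[of g UNIV UNIV]
  by simp

lemma permutes_two_points:
  assumes "i \<in> K" "j \<in> K" "i \<noteq> j" "i' \<in> K" "j' \<in> K" "i' \<noteq> j'"
  obtains \<pi> where "\<pi> permutes K" "\<pi> i = i'" "\<pi> j = j'"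
proof -
  define j'' where "j'' = Transposition.transpose i i' j"
  have "j'' \<in> K" "j'' \<noteq> i'" using assms by (auto simp: j''_def Transposition.transpose_def)
  then have "(Transposition.transpose j'' j' \<circ> Transposition.transpose i i') permutes K" using assms
    by (intro permutes_compose permutes_swap_id)
  moreover have "(Transposition.transpose j'' j' \<circ> Transposition.transpose i i') i = i'" "(Transposition.transpose j'' j' \<circ> Transposition.transpose i i') j = j'"
    using assms \<open>j'' \<noteq> i'\<close> by (auto simp: Transposition.transpose_def j''_def)
  ultimately show thesis by (rule that)
qed

text \<open>The one-step analysis uses nothing about trees except exchangeability: a relabelling of
  the colours is matched by a relabelling of the observations. Hence an integral involving one
  colour is the same for all colours, and one involving two colours is the same for all
  pairs.\<close>

locale colour_family =
  fixes K :: "'c set" and P :: "'c \<Rightarrow> 'o pmf"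
  assumes finK: "finite K" and card: "2 \<le> card K"
    and sym: "\<pi> permutes K \<Longrightarrow> \<exists>g. bij g \<and> (\<forall>i\<in>K. P (\<pi> i) = map_pmf g (P i))"
begin

text \<open>
  Unnormalised densities: the posterior of colour \<open>i\<close> given \<open>y\<close> is \<open>p i y / S y\<close>, and \<open>q i\<close> is the
  law of the observation from a child of a vertex coloured \<open>i\<close>.
\<close>

definition k :: real where "k = real (card K)"
definition p :: "'c \<Rightarrow> 'o \<Rightarrow> real" where "p i y = pmf (P i) y"
definition S :: "'o \<Rightarrow> real" where "S y = (\<Sum>i\<in>K. p i y)"
definition x :: real where "x = total (\<lambda>y. loss K (\<lambda>i. p i y)) / k"
definition q :: "'c \<Rightarrow> 'o \<Rightarrow> real" where "q i y = (S y - p i y) / (k - 1)"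
definition B :: "'c \<Rightarrow> 'c \<Rightarrow> real" where "B i j = total (\<lambda>y. sqrt (q i y * q j y))"

lemma k2: "2 \<le> k" using card by (simp add: k_def)

lemma vec: "nonneg_vector K (\<lambda>i. p i y)"
  by unfold_locales (auto simp: finK p_def)

lemma p_nonneg [simp]: "0 \<le> p i y" by (simp add: p_def)
lemma S_nonneg [simp]: "0 \<le> S y" by (simp add: S_def sum_nonneg)
lemma p_le_S: "i \<in> K \<Longrightarrow> p i y \<le> S y" using nonneg_vector.le_S[OF vec] by (simp add: S_def)

lemma integrable_p [simp]: "integrable (count_space UNIV) (p i)"
  unfolding p_def by (rule integrable_pmf)
lemma total_p: "total (p i) = 1"
  unfolding p_def integral_pmf by simp
lemma integrable_S [simp]: "integrable (count_space UNIV) S"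
  unfolding S_def by simp
lemma total_S: "total S = k"
  unfolding S_def by (subst Bochner_Integration.integral_sum) (simp_all add: total_p k_def)

lemma integrable_le_S:
  assumes "\<And>y. \<bar>f y\<bar> \<le> C * S y"
  shows "integrable (count_space UNIV) f"
proof (rule Bochner_Integration.integrable_bound)
  show "integrable (count_space UNIV) (\<lambda>y. C * S y)" by simp
  show "AE y in count_space UNIV. norm (f y) \<le> norm (C * S y)"
    using assms by (intro AE_I2) (auto intro: order.trans[OF _ abs_ge_self])
qed simp

section \<open>Symmetry between the colours\<close>

lemma total_permute:
  assumes "\<pi> permutes K" and F: "\<And>r r'. (\<And>i. i \<in> K \<Longrightarrow> r i = r' i) \<Longrightarrow> F r = F r'"
  shows "total (\<lambda>y. F (\<lambda>i. p i y)) = total (\<lambda>y. F (\<lambda>i. p (\<pi> i) y))"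
proof -
  obtain g where g: "bij g" "\<And>i. i \<in> K \<Longrightarrow> P (\<pi> i) = map_pmf g (P i)" using sym[OF assms(1)] by blast
  have "p (\<pi> i) (g y) = p i y" if "i \<in> K" for i y
    unfolding p_def g(2)[OF that] using g(1) by (intro pmf_map_inj') (simp add: bij_def)
  then have "F (\<lambda>i. p i y) = F (\<lambda>i. p (\<pi> i) (g y))" for y by (intro F) auto
  then show ?thesis using total_bij[OF g(1), of "\<lambda>y. F (\<lambda>i. p (\<pi> i) y)"] by simp
qed

text \<open>\<open>D\<close> is the drop in the expansion of the Bhattacharyya coefficient, products
  of two \<open>U\<close> form its cross term, and \<open>W\<close> dominates the errors made by
  restricting to moderate posteriors.\<close>

definition U where "U l y = sqrt (S y) - sqrt (S y - p l y)"
definition D where "D l y = sqrt (S y) * U l y"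
definition W where "W l y = p l y * sqrt (1 - p l y / S y)"
definition L where "L y = loss K (\<lambda>i. p i y)"

lemma U_eq: "nonneg_vector.u K (\<lambda>i. p i y) l = U l y"
  unfolding nonneg_vector.u_def[OF vec] U_def S_def ..

lemma U_nonneg: "0 \<le> U l y" by (simp add: U_def)
lemma U_le: "l \<in> K \<Longrightarrow> U l y \<le> sqrt (S y)" using p_le_S by (simp add: U_def)
lemma D_nonneg: "0 \<le> D l y" by (simp add: D_def U_nonneg)
lemma L_nonneg: "0 \<le> L y" unfolding L_def by (rule nonneg_vector.loss_nonneg[OF vec])
lemma W_nonneg: "l \<in> K \<Longrightarrow> 0 \<le> W l y"
proof -
  assume "l \<in> K"
  then have "p l y / S y \<le> 1" using p_le_S[of l y] S_nonneg[of y] by (intro divide_le_eq_1[THEN iffD2]) linarith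
  then show ?thesis unfolding W_def by (intro mult_nonneg_nonneg) auto
qed

lemma sum_D: "(\<Sum>l\<in>K. D l y) = S y - L y"
  using nonneg_vector.sum_u[OF vec, of y] by (simp add: U_eq D_def L_def S_def)
lemma L_le_S: "L y \<le> S y" using sum_D[of y] sum_nonneg[of K "\<lambda>l. D l y"] D_nonneg by auto

lemma integrable_L [simp]: "integrable (count_space UNIV) L"
  by (rule integrable_le_S[of _ 1]) (use L_nonneg L_le_S in auto)
lemma integrable_D: "l \<in> K \<Longrightarrow> integrable (count_space UNIV) (D l)"
proof (rule integrable_le_S[of _ 1])
  fix y assume "l \<in> K"
  then have "D l y \<le> sqrt (S y) * sqrt (S y)" unfolding D_def by (intro mult_left_mono U_le) auto
  then show "\<bar>D l y\<bar> \<le> 1 * S y" using D_nonneg[of l y] by simp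
qed
lemma integrable_W: "l \<in> K \<Longrightarrow> integrable (count_space UNIV) (W l)"
proof (rule integrable_le_S[of _ 1])
  fix y assume l: "l \<in> K"
  have "W l y \<le> p l y * 1" unfolding W_def by (intro mult_left_mono) auto
  then show "\<bar>W l y\<bar> \<le> 1 * S y" using W_nonneg[OF l, of y] p_le_S[OF l, of y] by simp
qed
lemma integrable_UU: "i \<in> K \<Longrightarrow> j \<in> K \<Longrightarrow> integrable (count_space UNIV) (\<lambda>y. U i y * U j y)"
proof (rule integrable_le_S[of _ 1])
  fix y assume "i \<in> K" "j \<in> K"
  then have "U i y * U j y \<le> sqrt (S y) * sqrt (S y)" by (intro mult_mono U_le U_nonneg) auto
  then show "\<bar>U i y * U j y\<bar> \<le> 1 * S y" using U_nonneg[of _ y] by simp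
qed

lemma total_L: "total L = k * x" using k2 by (simp add: x_def L_def[abs_def])
lemma x_nonneg: "0 \<le> x"
  unfolding x_def L_def[symmetric] using k2 L_nonneg by (intro divide_nonneg_nonneg Bochner_Integration.integral_nonneg) auto

lemma sum_permute_K: "\<pi> permutes K \<Longrightarrow> (\<Sum>i\<in>K. p (\<pi> i) y) = S y"
  unfolding S_def using sum.permute[of \<pi> K "\<lambda>i. p i y"] by (simp add: o_def)

lemma total_single:
  assumes l: "l \<in> K" "m \<in> K"
  shows "total (\<lambda>y. f (S y) (p l y)) = total (\<lambda>y. f (S y) (p m y))"
proof -
  have \<pi>: "Transposition.transpose l m permutes K" using l by (intro permutes_swap_id)
  have "total (\<lambda>y. f (\<Sum>i\<in>K. p i y) (p l y)) = total (\<lambda>y. f (\<Sum>i\<in>K. p (Transposition.transpose l m i) y) (p (Transposition.transpose l m l) y))"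
    by (rule total_permute[OF \<pi>, of "\<lambda>r. f (\<Sum>i\<in>K. r i) (r l)"]) (use l in \<open>auto cong: sum.cong\<close>)
  then show ?thesis unfolding sum_permute_K[OF \<pi>] by (simp add: S_def)
qed

lemma total_pair:
  assumes "i \<in> K" "j \<in> K" "i \<noteq> j" "i' \<in> K" "j' \<in> K" "i' \<noteq> j'"
  shows "total (\<lambda>y. f (S y) (p i y) (p j y)) = total (\<lambda>y. f (S y) (p i' y) (p j' y))"
proof -
  obtain \<pi> where \<pi>: "\<pi> permutes K" "\<pi> i = i'" "\<pi> j = j'" using permutes_two_points[OF assms] .
  have "total (\<lambda>y. f (\<Sum>i\<in>K. p i y) (p i y) (p j y)) = total (\<lambda>y. f (\<Sum>i\<in>K. p (\<pi> i) y) (p (\<pi> i) y) (p (\<pi> j) y))"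
    by (rule total_permute[OF \<pi>(1), of "\<lambda>r. f (\<Sum>i\<in>K. r i) (r i) (r j)"]) (use assms in \<open>auto cong: sum.cong\<close>)
  then show ?thesis unfolding sum_permute_K[OF \<pi>(1)] \<pi> by (simp add: S_def)
qed

text \<open>The drops sum over the colours to \<open>S - L\<close>, of total
  \<open>k - k * x\<close>, and symmetry gives each colour an equal share.\<close>

lemma total_D:
  assumes "l \<in> K" shows "total (D l) = 1 - x"
proof -
  have "total (D m) = total (D l)" if "m \<in> K" for m
    using total_single[OF that assms, of "\<lambda>s t. sqrt s * (sqrt s - sqrt (s - t))"]
    by (simp add: D_def[abs_def] U_def)
  then have "(\<Sum>m\<in>K. total (D m)) = k * total (D l)" by (simp add: k_def)
  moreover have "(\<Sum>m\<in>K. total (D m)) = total (\<lambda>y. \<Sum>m\<in>K. D m y)"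
    by (rule Bochner_Integration.integral_sum[symmetric]) (rule integrable_D)
  moreover have "total (\<lambda>y. \<Sum>m\<in>K. D m y) = k - k * x"
    unfolding sum_D by (simp add: total_S total_L)
  ultimately have "k * total (D l) = k * (1 - x)" by (simp add: algebra_simps)
  then show ?thesis using k2 by simp
qed

lemma total_W:
  assumes "l \<in> K" shows "total (W l) \<le> 4 * x"
proof -
  have "total (W m) = total (W l)" if "m \<in> K" for m
    using total_single[OF that assms, of "\<lambda>s t. t * sqrt (1 - t / s)"] by (simp add: W_def[abs_def])
  then have "k * total (W l) = (\<Sum>m\<in>K. total (W m))" by (simp add: k_def)
  also have "\<dots> = total (\<lambda>y. \<Sum>m\<in>K. W m y)"
    by (rule Bochner_Integration.integral_sum[symmetric]) (rule integrable_W)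
  also have "\<dots> \<le> total (\<lambda>y. 4 * L y)"
  proof (rule integral_mono)
    show "(\<Sum>m\<in>K. W m y) \<le> 4 * L y" for y
      using nonneg_vector.sum_weighted_le[OF vec, of y] by (simp add: W_def L_def S_def)
  qed (auto intro!: integrable_W)
  also have "\<dots> = k * (4 * x)" by (simp add: total_L)
  finally show ?thesis using k2 by simp
qed

text \<open>The loss controls the sum over all \<open>k * (k - 1)\<close> ordered pairs at once; a
  single pair gets an equal share, whence the extra division by \<open>k - 1\<close> that makes the
  cross term negligible.\<close>

lemma total_UU:
  assumes "i \<in> K" "j \<in> K" "i \<noteq> j"
  shows "total (\<lambda>y. U i y * U j y) \<le> 4 * x / (k - 1)"
proof -
  have eq: "total (\<lambda>y. U i' y * U j' y) = total (\<lambda>y. U i y * U j y)" if "i' \<in> K" "j' \<in> K - {i'}" for i' j'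
    using total_pair[of i' j' i j "\<lambda>s t t'. (sqrt s - sqrt (s - t)) * (sqrt s - sqrt (s - t'))"] that assms
    by (auto simp: U_def)
  have "k * (k - 1) * total (\<lambda>y. U i y * U j y) = (\<Sum>i'\<in>K. \<Sum>j'\<in>K-{i'}. total (\<lambda>y. U i y * U j y))"
    using card finK by (simp add: k_def of_nat_diff)
  also have "\<dots> = (\<Sum>i'\<in>K. \<Sum>j'\<in>K-{i'}. total (\<lambda>y. U i' y * U j' y))"
    by (intro sum.cong refl eq[symmetric])
  also have "\<dots> = total (\<lambda>y. \<Sum>i'\<in>K. \<Sum>j'\<in>K-{i'}. U i' y * U j' y)"
    by (subst Bochner_Integration.integral_sum, auto intro!: integrable_UU sum.cong)
       (subst Bochner_Integration.integral_sum, auto intro!: integrable_UU)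
  also have "\<dots> \<le> total (\<lambda>y. 4 * L y)"
  proof (rule integral_mono)
    show "(\<Sum>i'\<in>K. \<Sum>j'\<in>K-{i'}. U i' y * U j' y) \<le> 4 * L y" for y
      using nonneg_vector.sum_pairs_u_le[OF vec, of y] by (simp add: U_eq L_def)
  qed (auto intro!: integrable_UU)
  also have "\<dots> = k * (4 * x)" by (simp add: total_L)
  finally have "k * ((k - 1) * total (\<lambda>y. U i y * U j y)) \<le> k * (4 * x)" by (simp add: mult.assoc)
  then have "(k - 1) * total (\<lambda>y. U i y * U j y) \<le> 4 * x" using k2 by simp
  then show ?thesis using k2 by (simp add: field_simps)
qed

section \<open>The Bhattacharyya coefficient of a single child\<close>

lemma q_nonneg: "i \<in> K \<Longrightarrow> 0 \<le> q i y"
  unfolding q_def using p_le_S[of i y] k2 by simp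
lemma integrable_q [simp]: "integrable (count_space UNIV) (q i)"
  unfolding q_def by simp
lemma total_q: "total (q i) = 1"
  unfolding q_def using k2 by (simp add: total_S total_p)

lemma sqrt_qq: "sqrt (q i y * q j y) = sqrt ((S y - p i y) * (S y - p j y)) / (k - 1)"
  using k2 by (simp add: q_def real_sqrt_divide real_sqrt_mult)

lemma sqrt_pair_eq:
  assumes "i \<in> K" "j \<in> K"
  shows "sqrt ((S y - p i y) * (S y - p j y)) = S y - D i y - D j y + U i y * U j y"
  using nonneg_vector.sqrt_pair_eq[OF vec assms, of y] by (simp add: U_eq S_def D_def)

lemma integrable_sqrt_pair:
  assumes "i \<in> K" "j \<in> K"
  shows "integrable (count_space UNIV) (\<lambda>y. sqrt ((S y - p i y) * (S y - p j y)))"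
  unfolding sqrt_pair_eq[OF assms]
  by (intro Bochner_Integration.integrable_add Bochner_Integration.integrable_diff integrable_D integrable_UU integrable_S assms)

lemma integrable_sqrt_qq:
  "i \<in> K \<Longrightarrow> j \<in> K \<Longrightarrow> integrable (count_space UNIV) (\<lambda>y. sqrt (q i y * q j y))"
  unfolding sqrt_qq by (auto intro: integrable_sqrt_pair)

text \<open>Each of the two drops contributes \<open>1 - x\<close>. With \<open>x = 0\<close> and no
  cross term, \<open>1 - B\<close> would be \<open>1 / (k - 1)\<close>; the imperfect information
  costs \<open>2 * x\<close> of that numerator.\<close>

lemma B_eq:
  assumes "i \<in> K" "j \<in> K"
  shows "(k - 1) * B i j = k - 2 * (1 - x) + total (\<lambda>y. U i y * U j y)"
proof -
  have "(k - 1) * B i j = total (\<lambda>y. S y - D i y - D j y + U i y * U j y)"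
    unfolding B_def sqrt_qq sqrt_pair_eq[OF assms] using k2 by simp
  also have "\<dots> = k - (1 - x) - (1 - x) + total (\<lambda>y. U i y * U j y)"
    using assms by (simp add: integrable_D integrable_UU total_D total_S)
  finally show ?thesis by simp
qed

lemma B_upper:
  assumes "i \<in> K" "j \<in> K" "i \<noteq> j"
  shows "B i j \<le> 1 - (1 - 2 * x - 4 * x / (k - 1)) / (k - 1)"
proof -
  have "(k - 1) * B i j \<le> k - 2 * (1 - x) + 4 * x / (k - 1)"
    unfolding B_eq[OF assms(1,2)] using total_UU[OF assms] by simp
  then have "B i j \<le> (k - 2 * (1 - x) + 4 * x / (k - 1)) / (k - 1)"
    using k2 by (simp add: pos_le_divide_eq mult.commute)
  also have "\<dots> = ((k - 1) - (1 - 2 * x - 4 * x / (k - 1))) / (k - 1)"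
    by (simp add: algebra_simps)
  also have "\<dots> = 1 - (1 - 2 * x - 4 * x / (k - 1)) / (k - 1)"
    using k2 by (subst diff_divide_distrib) simp
  finally show ?thesis .
qed

lemma B_lower:
  assumes "i \<in> K" "j \<in> K"
  shows "(k - 2) / (k - 1) \<le> B i j"
proof -
  have "0 \<le> total (\<lambda>y. U i y * U j y)"
    by (intro Bochner_Integration.integral_nonneg mult_nonneg_nonneg U_nonneg)
  then have "k - 2 \<le> (k - 1) * B i j" unfolding B_eq[OF assms] using x_nonneg by simp
  then show ?thesis using k2 by (simp add: pos_divide_le_eq mult.commute)
qed

lemma B_le_1:
  assumes "i \<in> K" "j \<in> K" shows "B i j \<le> 1"
proof -
  have "B i j \<le> total (\<lambda>y. (q i y + q j y) / 2)"
    unfolding B_def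
  proof (rule integral_mono)
    show "sqrt (q i y * q j y) \<le> (q i y + q j y) / 2" for y
      by (rule arith_geo_mean_sqrt) (simp_all add: q_nonneg assms)
  qed (use assms in \<open>auto intro!: integrable_sqrt_qq\<close>)
  also have "\<dots> = 1" by (simp add: total_q)
  finally show ?thesis .
qed

text \<open>On the complement of \<open>G\<close> likelihood ratios are unbounded; it carries mass \<open>O(x / k)\<close> only.\<close>

definition G :: "'c \<Rightarrow> 'c \<Rightarrow> 'o \<Rightarrow> real" where
  "G i j y = (if p i y \<le> S y / 2 \<and> p j y \<le> S y / 2 then 1 else 0)"
definition BG where "BG i j = total (\<lambda>y. sqrt (q i y * q j y) * G i j y)"
definition QG where "QG i j = total (\<lambda>y. q i y * G i j y)"

lemma G_cases: "G i j y = 0 \<or> G i j y = 1" by (simp add: G_def)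

lemma integrable_G:
  assumes "integrable (count_space UNIV) f" shows "integrable (count_space UNIV) (\<lambda>y. f y * G i j y)"
  by (rule Bochner_Integration.integrable_bound[OF assms]) (auto simp: G_def)

lemma S_mult_sqrt:
  assumes "i \<in> K" "S y > 0" shows "sqrt (S y * (S y - p i y)) = S y * sqrt (1 - p i y / S y)"
  using nonneg_vector.sqrt_mult_diff[OF vec, of y i] assms by (simp add: S_def)

text \<open>A posterior above 1/2 means \<open>S \<le> 2 * p i\<close>, which turns
  \<open>sqrt (S * (S - p i))\<close> into a multiple of \<open>W i\<close>.\<close>

lemma off_G_le:
  assumes "i \<in> K" "j \<in> K" "p i y > S y / 2"
  shows "sqrt ((S y - p i y) * (S y - p j y)) \<le> 2 * W i y"
proof -
  have S: "S y > 0" using assms p_le_S[of i y] by linarith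
  have "(S y - p i y) * (S y - p j y) \<le> (S y - p i y) * S y"
    using p_le_S[of i y] assms by (intro mult_left_mono) auto
  then have "sqrt ((S y - p i y) * (S y - p j y)) \<le> sqrt (S y * (S y - p i y))"
    by (simp add: mult.commute)
  also have "\<dots> = S y * sqrt (1 - p i y / S y)" using assms S by (intro S_mult_sqrt)
  also have "\<dots> \<le> (2 * p i y) * sqrt (1 - p i y / S y)"
    using assms S p_le_S[of i y] by (intro mult_right_mono) auto
  finally show ?thesis by (simp add: W_def)
qed

text \<open>A posterior of at most 1/2 keeps the root in \<open>W i\<close> above 1/2.\<close>

lemma on_G_le:
  assumes "i \<in> K" "p i y \<le> S y / 2"
  shows "p i y \<le> 2 * W i y"
proof (cases "S y = 0")
  case True
  then show ?thesis using p_le_S[OF assms(1), of y] W_nonneg[OF assms(1), of y] by simp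
next
  case False
  then have S: "S y > 0" using S_nonneg[of y] by linarith
  have "1/2 \<le> sqrt (1 - p i y / S y)"
    using assms S by (intro real_le_rsqrt) (auto simp: power2_eq_square field_simps)
  then have "p i y * (1/2) \<le> p i y * sqrt (1 - p i y / S y)" by (intro mult_left_mono) auto
  then show ?thesis by (simp add: W_def)
qed

text \<open>Off \<open>G\<close> one of the two colours has posterior above 1/2, and the geometric
  mean is at most twice the corresponding \<open>W\<close>. Each \<open>W\<close> has total at most
  \<open>4 * x\<close>, so both together give 16.\<close>

lemma B_minus_BG:
  assumes "i \<in> K" "j \<in> K"
  shows "B i j - BG i j \<le> 16 * x / (k - 1)"
proof -
  have "B i j - BG i j = total (\<lambda>y. sqrt (q i y * q j y) - sqrt (q i y * q j y) * G i j y)"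
    unfolding B_def BG_def using assms by (simp add: integrable_sqrt_qq integrable_G)
  also have "\<dots> \<le> total (\<lambda>y. (2 * W i y + 2 * W j y) / (k - 1))"
  proof (rule integral_mono)
    fix y
    have "sqrt ((S y - p i y) * (S y - p j y)) - sqrt ((S y - p i y) * (S y - p j y)) * G i j y
        \<le> 2 * W i y + 2 * W j y"
      using off_G_le[OF assms, of y] off_G_le[OF assms(2,1), of y] W_nonneg[OF assms(1), of y] W_nonneg[OF assms(2), of y]
      by (auto simp: G_def mult.commute)
    then have "(sqrt ((S y - p i y) * (S y - p j y)) - sqrt ((S y - p i y) * (S y - p j y)) * G i j y) / (k - 1)
        \<le> (2 * W i y + 2 * W j y) / (k - 1)"
      using k2 by (intro divide_right_mono) auto
    then show "sqrt (q i y * q j y) - sqrt (q i y * q j y) * G i j y \<le> (2 * W i y + 2 * W j y) / (k - 1)"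
      unfolding sqrt_qq by (simp add: diff_divide_distrib)
  qed (use assms in \<open>auto intro!: integrable_sqrt_qq integrable_G integrable_W integrable_divide\<close>)
  also have "\<dots> = (2 * total (W i) + 2 * total (W j)) / (k - 1)"
    using assms by (simp add: integrable_W)
  also have "\<dots> \<le> 16 * x / (k - 1)"
    using total_W[OF assms(1)] total_W[OF assms(2)] k2 by (intro divide_right_mono) auto
  finally show ?thesis .
qed

lemma diff_sqrt_mult_le: "0 \<le> a \<Longrightarrow> 0 \<le> b \<Longrightarrow> a - sqrt (a * b) \<le> \<bar>a - b\<bar>" for a b :: real
proof (cases "a \<le> b")
  case True
  assume "0 \<le> a" "0 \<le> b"
  then have "a * a \<le> a * b" using True by (intro mult_left_mono)
  then have "a \<le> sqrt (a * b)" by (intro real_le_rsqrt) (simp add: power2_eq_square)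
  then show ?thesis by simp
next
  case False
  assume "0 \<le> a" "0 \<le> b"
  then have "b * b \<le> a * b" using False by (intro mult_right_mono) auto
  then have "b \<le> sqrt (a * b)" by (intro real_le_rsqrt) (simp add: power2_eq_square)
  then show ?thesis using False by simp
qed

text \<open>On \<open>G\<close> the two child densities differ by at most \<open>p i + p j\<close>,
  up to the normalisation, and there \<open>p\<close> is bounded by \<open>W\<close>. Together with
  the preceding estimate this shows that replacing \<open>BG\<close> by \<open>B\<close> or
  \<open>QG\<close> raises the mass by at most \<open>O(x / k)\<close>, which costs only a bounded
  factor in the generating function when \<open>d * x / k\<close> is bounded.\<close>

lemma QG_minus_BG:
  assumes "i \<in> K" "j \<in> K"
  shows "QG i j - BG i j \<le> 16 * x / (k - 1)"
proof -
  have "QG i j - BG i j = total (\<lambda>y. q i y * G i j y - sqrt (q i y * q j y) * G i j y)"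
    unfolding QG_def BG_def using assms by (simp add: integrable_sqrt_qq integrable_G)
  also have "\<dots> \<le> total (\<lambda>y. (2 * W i y + 2 * W j y) / (k - 1))"
  proof (rule integral_mono)
    fix y
    have "(S y - p i y) * G i j y - sqrt ((S y - p i y) * (S y - p j y)) * G i j y
        \<le> 2 * W i y + 2 * W j y"
    proof (cases "p i y \<le> S y / 2 \<and> p j y \<le> S y / 2")
      case True
      have "(S y - p i y) - sqrt ((S y - p i y) * (S y - p j y)) \<le> \<bar>(S y - p i y) - (S y - p j y)\<bar>"
        using p_le_S assms by (intro diff_sqrt_mult_le) auto
      also have "\<dots> \<le> p i y + p j y" using p_nonneg[of i y] p_nonneg[of j y] by linarith
      also have "\<dots> \<le> 2 * W i y + 2 * W j y" using True assms by (intro add_mono on_G_le) auto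
      finally show ?thesis using True by (simp add: G_def)
    next
      case False
      then have "G i j y = 0" by (simp add: G_def)
      then show ?thesis using W_nonneg[OF assms(1), of y] W_nonneg[OF assms(2), of y] by simp
    qed
    then have "((S y - p i y) * G i j y - sqrt ((S y - p i y) * (S y - p j y)) * G i j y) / (k - 1)
        \<le> (2 * W i y + 2 * W j y) / (k - 1)"
      using k2 by (intro divide_right_mono) auto
    then show "q i y * G i j y - sqrt (q i y * q j y) * G i j y \<le> (2 * W i y + 2 * W j y) / (k - 1)"
      unfolding sqrt_qq unfolding q_def times_divide_eq_left diff_divide_distrib[symmetric] .
  qed (use assms in \<open>auto intro!: integrable_sqrt_qq integrable_G integrable_W integrable_divide\<close>)
  also have "\<dots> = (2 * total (W i) + 2 * total (W j)) / (k - 1)"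
    using assms by (simp add: integrable_W)
  also have "\<dots> \<le> 16 * x / (k - 1)"
    using total_W[OF assms(1)] total_W[OF assms(2)] k2 by (intro divide_right_mono) auto
  finally show ?thesis .
qed

lemma QG_le_1: "i \<in> K \<Longrightarrow> QG i j \<le> 1"
proof -
  assume i: "i \<in> K"
  have "QG i j \<le> total (q i)" unfolding QG_def
  proof (rule integral_mono)
    show "q i y * G i j y \<le> q i y" for y using q_nonneg[OF i, of y] by (simp add: G_def)
  qed (auto intro!: integrable_G)
  then show ?thesis by (simp add: total_q)
qed

lemma BG_le_B:
  assumes "i \<in> K" "j \<in> K" shows "BG i j \<le> B i j"
  unfolding BG_def B_def
proof (rule integral_mono)
  show "sqrt (q i y * q j y) * G i j y \<le> sqrt (q i y * q j y)" for y
    using q_nonneg[OF assms(1), of y] q_nonneg[OF assms(2), of y] by (simp add: G_def)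
qed (use assms in \<open>auto intro!: integrable_G integrable_sqrt_qq\<close>)

lemma G_commute: "G i j y = G j i y" by (auto simp: G_def)

end

section \<open>Harmonic means and the update of the order parameter\<close>

lemma harmonic_ge:
  fixes a b t :: real
  assumes "0 \<le> a" "0 \<le> b"
  shows "2 * t * sqrt (a * b) - t\<^sup>2 * (a + b) \<le> a * b / (a + b)"
proof (cases "a + b = 0")
  case True
  then have "a = 0" "b = 0" using assms by auto
  then show ?thesis by simp
next
  case False
  then have pos: "a + b > 0" using assms by simp
  \<comment> \<open>The bound is sharp at \<open>t = sqrt (a * b) / (a + b)\<close>. A single
    \<open>t\<close> for all observations is used later, because then every term is a product over
    the children.\<close>
  have "0 \<le> (sqrt (a * b) - t * (a + b))\<^sup>2" by simp
  also have "\<dots> = a * b - (2 * t * sqrt (a * b) - t\<^sup>2 * (a + b)) * (a + b)"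
    using assms by (simp add: power2_diff power_mult_distrib) (simp add: power2_eq_square algebra_simps)
  finally show ?thesis using pos by (simp add: pos_le_divide_eq)
qed

context colour_family
begin

text \<open>\<open>lw \<xi> i\<close> is the law of the list of observations from the children of a vertex coloured \<open>i\<close>.\<close>

definition lw :: "nat pmf \<Rightarrow> 'c \<Rightarrow> 'o list \<Rightarrow> real" where
  "lw \<xi> i os = pmf \<xi> (length os) * prod_list (map (q i) os)"

lemma prod_list_q_nonneg: "i \<in> K \<Longrightarrow> 0 \<le> prod_list (map (q i) os)"
  by (induction os) (auto simp: q_nonneg)

lemma lw_nonneg: "i \<in> K \<Longrightarrow> 0 \<le> lw \<xi> i os"
  unfolding lw_def by (intro mult_nonneg_nonneg prod_list_q_nonneg) auto

lemma sqrt_lw: "sqrt (lw \<xi> i os * lw \<xi> j os) = pmf \<xi> (length os) * prod_list (map (\<lambda>y. sqrt (q i y * q j y)) os)"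
proof -
  have "sqrt (prod_list (map (q i) os) * prod_list (map (q j) os)) = prod_list (map (\<lambda>y. sqrt (q i y * q j y)) os)"
    by (induction os) (simp_all add: real_sqrt_mult mult_ac)
  moreover have "lw \<xi> i os * lw \<xi> j os
      = (pmf \<xi> (length os))\<^sup>2 * (prod_list (map (q i) os) * prod_list (map (q j) os))"
    by (simp add: lw_def power2_eq_square mult_ac)
  ultimately show ?thesis by (simp add: real_sqrt_mult)
qed

lemma total_sqrt_lw:
  assumes "i \<in> K" "j \<in> K"
  shows "integrable (count_space UNIV) (\<lambda>os. sqrt (lw \<xi> i os * lw \<xi> j os))"
    and "total (\<lambda>os. sqrt (lw \<xi> i os * lw \<xi> j os)) = pgf \<xi> (B i j)"
  unfolding sqrt_lw B_def using assms B_le_1[OF assms]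
  by (auto intro!: total_list_weights integrable_sqrt_qq simp: q_nonneg B_def)

lemma prod_list_G:
  "prod_list (map (\<lambda>y. f y * G i j y) os) = prod_list (map f os) * prod_list (map (G i j) os)"
  by (induction os) (simp_all add: mult_ac)

lemma prod_list_G_cases: "prod_list (map (G i j) os) = 0 \<or> prod_list (map (G i j) os) = 1"
proof (induction os)
  case (Cons y os)
  then show ?case using G_cases[of i j y] by auto
qed simp

lemma G_nonneg: "0 \<le> G i j y" by (simp add: G_def)

lemma integrable_harmonic_lw:
  assumes "i \<in> K" "j \<in> K"
  shows "integrable (count_space UNIV) (\<lambda>os. lw \<xi> i os * lw \<xi> j os / (lw \<xi> i os + lw \<xi> j os))"
proof (rule Bochner_Integration.integrable_bound[OF total_sqrt_lw(1)[OF assms]])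
  have "lw \<xi> i os * lw \<xi> j os / (lw \<xi> i os + lw \<xi> j os) \<le> sqrt (lw \<xi> i os * lw \<xi> j os)" for os
    using harmonic_le_sqrt[OF lw_nonneg[OF assms(1)] lw_nonneg[OF assms(2)], of \<xi> os \<xi> os]
      real_sqrt_ge_zero[OF mult_nonneg_nonneg[OF lw_nonneg[OF assms(1)] lw_nonneg[OF assms(2)]], of \<xi> os \<xi> os]
    by linarith
  then show "AE os in count_space UNIV. norm (lw \<xi> i os * lw \<xi> j os / (lw \<xi> i os + lw \<xi> j os)) \<le> norm (sqrt (lw \<xi> i os * lw \<xi> j os))"
    using lw_nonneg assms by (intro AE_I2) simp
qed simp

text \<open>
  The harmonic mean is not multiplicative over the children, but the bound \<open>harmonic_ge\<close>,
  applied where all children lie in \<open>G\<close>, is a combination of product weights.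
\<close>

lemma total_harmonic_lw_ge:
  assumes "i \<in> K" "j \<in> K"
  shows "2 * t * pgf \<xi> (BG i j) - t\<^sup>2 * (pgf \<xi> (QG i j) + pgf \<xi> (QG j i))
      \<le> total (\<lambda>os. lw \<xi> i os * lw \<xi> j os / (lw \<xi> i os + lw \<xi> j os))"
proof -
  let ?w = "\<lambda>os. prod_list (map (G i j) os)"
  let ?a = "\<lambda>os. pmf \<xi> (length os) * prod_list (map (\<lambda>y. sqrt (q i y * q j y) * G i j y) os)"
  let ?b = "\<lambda>i' os. pmf \<xi> (length os) * prod_list (map (\<lambda>y. q i' y * G i j y) os)"
  have a: "integrable (count_space UNIV) ?a" "total ?a = pgf \<xi> (BG i j)"
    unfolding BG_def using assms BG_le_B[OF assms] B_le_1[OF assms]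
    by (auto intro!: total_list_weights integrable_G integrable_sqrt_qq simp: q_nonneg BG_def G_nonneg)
  have b: "integrable (count_space UNIV) (?b i)" "total (?b i) = pgf \<xi> (QG i j)"
    unfolding QG_def using assms QG_le_1[OF assms(1)]
    by (auto intro!: total_list_weights integrable_G simp: q_nonneg QG_def G_nonneg)
  have c: "integrable (count_space UNIV) (?b j)" "total (?b j) = pgf \<xi> (QG j i)"
    unfolding QG_def G_commute[of j i] using assms QG_le_1[OF assms(2), of i]
    by (auto intro!: total_list_weights integrable_G simp: q_nonneg QG_def G_nonneg G_commute[of j i])
  have "2 * t * pgf \<xi> (BG i j) - t\<^sup>2 * (pgf \<xi> (QG i j) + pgf \<xi> (QG j i))
      = total (\<lambda>os. 2 * t * ?a os - t\<^sup>2 * (?b i os + ?b j os))"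
    using a b c by simp
  also have "\<dots> \<le> total (\<lambda>os. lw \<xi> i os * lw \<xi> j os / (lw \<xi> i os + lw \<xi> j os))"
  proof (rule integral_mono)
    fix os
    \<comment> \<open>\<open>?w\<close> is the indicator that all children lie in \<open>G\<close>.
      Where it vanishes, nonnegativity of the harmonic term is enough.\<close>
    have "2 * t * ?a os - t\<^sup>2 * (?b i os + ?b j os)
        = (2 * t * sqrt (lw \<xi> i os * lw \<xi> j os) - t\<^sup>2 * (lw \<xi> i os + lw \<xi> j os)) * ?w os"
      unfolding sqrt_lw prod_list_G by (simp add: lw_def algebra_simps)
    also have "\<dots> \<le> lw \<xi> i os * lw \<xi> j os / (lw \<xi> i os + lw \<xi> j os)"
      using prod_list_G_cases[of i j os] harmonic_ge[OF lw_nonneg[OF assms(1)] lw_nonneg[OF assms(2)], of t \<xi> os \<xi> os]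
        lw_nonneg assms by auto
    finally show "2 * t * ?a os - t\<^sup>2 * (?b i os + ?b j os) \<le> lw \<xi> i os * lw \<xi> j os / (lw \<xi> i os + lw \<xi> j os)" .
  qed (use a b c assms in \<open>auto intro!: integrable_harmonic_lw\<close>)
  finally show ?thesis .
qed

definition x' :: "nat pmf \<Rightarrow> real" where "x' \<xi> = total (\<lambda>os. loss K (\<lambda>i. lw \<xi> i os)) / k"

lemma vec_lw: "nonneg_vector K (\<lambda>i. lw \<xi> i os)"
  by unfold_locales (auto simp: finK lw_nonneg)

text \<open>This integrates \<open>loss_le_pairs\<close>: there are \<open>k * (k - 1)\<close>
  ordered pairs, and the factor 2 together with the normalisation of \<open>x'\<close> by
  \<open>k\<close> leaves \<open>(k - 1) / 2\<close>.\<close>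

lemma x'_le:
  assumes M: "\<And>i j. i \<in> K \<Longrightarrow> j \<in> K \<Longrightarrow> i \<noteq> j \<Longrightarrow>
    pgf \<xi> (B i j) - total (\<lambda>os. lw \<xi> i os * lw \<xi> j os / (lw \<xi> i os + lw \<xi> j os)) / 20 \<le> M"
  shows "x' \<xi> \<le> (k - 1) / 2 * M"
proof -
  let ?s = "\<lambda>i j os. sqrt (lw \<xi> i os * lw \<xi> j os)"
  let ?h = "\<lambda>i j os. lw \<xi> i os * lw \<xi> j os / (lw \<xi> i os + lw \<xi> j os)"
  have int: "integrable (count_space UNIV) (\<lambda>os. ?s i j os - ?h i j os / 20)" if "i \<in> K" "j \<in> K" for i j
    using that by (intro Bochner_Integration.integrable_diff integrable_divide integrable_harmonic_lw total_sqrt_lw(1))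
  have "2 * (k * x' \<xi>) = 2 * total (\<lambda>os. loss K (\<lambda>i. lw \<xi> i os))" using k2 by (simp add: x'_def)
  also have "\<dots> = total (\<lambda>os. 2 * loss K (\<lambda>i. lw \<xi> i os))" by simp
  also have "\<dots> \<le> total (\<lambda>os. \<Sum>i\<in>K. \<Sum>j\<in>K-{i}. ?s i j os - ?h i j os / 20)"
  \<comment> \<open>Integrability of the majorant suffices since it is nonnegative, which in turn
    follows from nonnegativity of the loss below it.\<close>
  proof (rule Bochner_Integration.integral_mono')
    show "integrable (count_space UNIV) (\<lambda>os. \<Sum>i\<in>K. \<Sum>j\<in>K-{i}. ?s i j os - ?h i j os / 20)"
      by (intro Bochner_Integration.integrable_sum int) auto
    show "2 * loss K (\<lambda>i. lw \<xi> i os) \<le> (\<Sum>i\<in>K. \<Sum>j\<in>K-{i}. ?s i j os - ?h i j os / 20)" for os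
      by (rule nonneg_vector.loss_le_pairs[OF vec_lw])
    show "0 \<le> (\<Sum>i\<in>K. \<Sum>j\<in>K-{i}. ?s i j os - ?h i j os / 20)" for os
      using nonneg_vector.loss_le_pairs[OF vec_lw, of \<xi> os] nonneg_vector.loss_nonneg[OF vec_lw, of \<xi> os]
      by linarith
  qed
  also have "\<dots> = (\<Sum>i\<in>K. \<Sum>j\<in>K-{i}. total (\<lambda>os. ?s i j os - ?h i j os / 20))"
    by (subst Bochner_Integration.integral_sum, intro Bochner_Integration.integrable_sum int, simp, simp, intro sum.cong refl)
       (subst Bochner_Integration.integral_sum, intro int, auto)
  also have "\<dots> = (\<Sum>i\<in>K. \<Sum>j\<in>K-{i}. pgf \<xi> (B i j) - total (?h i j) / 20)"
    by (intro sum.cong refl, subst Bochner_Integration.integral_diff)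
       (auto simp del: divide_divide_eq_left intro!: total_sqrt_lw(1) integrable_divide integrable_harmonic_lw simp: total_sqrt_lw(2))
  also have "\<dots> \<le> (\<Sum>i\<in>K. \<Sum>j\<in>K-{i}. M)" by (intro sum_mono M) auto
  also have "\<dots> = k * ((k - 1) * M)" using card finK by (simp add: k_def of_nat_diff)
  finally have "k * (2 * x' \<xi>) \<le> k * ((k - 1) * M)" by (simp add: mult_ac)
  then show ?thesis using k2 by simp
qed

end

section \<open>Regular and Poisson offspring\<close>

text \<open>The two properties of the offspring law that the one-step bound uses, common to the
  regular and the Poisson case. The growth rate is \<open>2 * d\<close> on account of the regular
  case, where the ratio is \<open>(t / s) ^ d\<close> and \<open>t / s \<le> 1 + 2 * (t - s)\<close>
  for \<open>s \<ge> 1/2\<close>.\<close>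

definition poisson_like :: "nat pmf \<Rightarrow> real \<Rightarrow> bool" where
  "poisson_like \<xi> d \<longleftrightarrow> 0 \<le> d \<and>
     (\<forall>s. 0 \<le> s \<longrightarrow> s \<le> 1 \<longrightarrow> pgf \<xi> s \<le> exp (- d * (1 - s))) \<and>
     (\<forall>s t. 1/2 \<le> s \<longrightarrow> s \<le> t \<longrightarrow> t \<le> 1 \<longrightarrow> pgf \<xi> t \<le> exp (2 * d * (t - s)) * pgf \<xi> s)"

lemma poisson_like_return: "poisson_like (return_pmf d) (real d)"
proof -
  have "s ^ d \<le> exp (- real d * (1 - s))" if "0 \<le> s" for s :: real
  proof -
    have "s \<le> exp (s - 1)" using exp_ge_add_one_self[of "s - 1"] by simp
    then have "s ^ d \<le> exp (s - 1) ^ d" using that by (rule power_mono)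
    also have "\<dots> = exp (- real d * (1 - s))" by (simp add: exp_of_nat_mult[symmetric] algebra_simps)
    finally show ?thesis .
  qed
  moreover have "t ^ d \<le> exp (2 * real d * (t - s)) * s ^ d" if "1/2 \<le> s" "s \<le> t" for s t :: real
  proof -
    have "t - s \<le> s * (2 * (t - s))" using mult_right_mono[of 1 "2 * s" "t - s"] that by (simp add: mult_ac)
    then have "t \<le> s * (1 + 2 * (t - s))" by (simp add: algebra_simps)
    also have "\<dots> \<le> s * exp (2 * (t - s))" using that exp_ge_add_one_self by (intro mult_left_mono) auto
    finally have "t ^ d \<le> (s * exp (2 * (t - s))) ^ d" using that by (intro power_mono) auto
    also have "\<dots> = exp (2 * real d * (t - s)) * s ^ d"
      by (simp add: power_mult_distrib exp_of_nat_mult[symmetric] mult_ac)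
    finally show ?thesis .
  qed
  ultimately show ?thesis by (simp add: poisson_like_def pgf_def)
qed

lemma pgf_poisson:
  assumes "0 < d" "0 \<le> s" "s \<le> 1" shows "pgf (poisson_pmf d) s = exp (- d * (1 - s))"
proof -
  have "((\<lambda>n. (s * d) ^ n /\<^sub>R fact n) sums exp (s * d))" by (rule exp_converges)
  then have "(\<lambda>n. (s * d) ^ n /\<^sub>R fact n * exp (- d)) sums (exp (s * d) * exp (- d))" by (rule sums_mult2)
  then have *: "(\<lambda>n. pmf (poisson_pmf d) n * s ^ n) sums exp (- d * (1 - s))"
    using assms by (simp add: exp_add[symmetric] power_mult_distrib field_simps)
  have "pgf (poisson_pmf d) s = (\<integral>n. pmf (poisson_pmf d) n * s ^ n \<partial>count_space UNIV)"
    unfolding pgf_def measure_pmf_eq_density by (subst integral_density) auto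
  also have "\<dots> = (\<Sum>n. pmf (poisson_pmf d) n * s ^ n)"
  proof (rule integral_count_space_nat)
    show "integrable (count_space UNIV) (\<lambda>n. pmf (poisson_pmf d) n * s ^ n)"
      using integrable_pgf[OF assms(2,3), of "poisson_pmf d"] unfolding measure_pmf_eq_density
      by (subst (asm) integrable_density) auto
  qed
  finally show ?thesis using * by (simp add: sums_iff)
qed

lemma poisson_like_poisson: "0 < d \<Longrightarrow> poisson_like (poisson_pmf d) d"
  unfolding poisson_like_def
proof (intro conjI allI impI)
  fix s t :: real assume a: "0 < d" "1/2 \<le> s" "s \<le> t" "t \<le> 1"
  have "exp (- d * (1 - t)) = exp (d * (t - s)) * exp (- d * (1 - s))"
    by (simp add: exp_add[symmetric] algebra_simps)
  also have "\<dots> \<le> exp (2 * d * (t - s)) * exp (- d * (1 - s))"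
    using a by (intro mult_right_mono) auto
  finally show "pgf (poisson_pmf d) t \<le> exp (2 * d * (t - s)) * pgf (poisson_pmf d) s"
    using a by (simp add: pgf_poisson)
qed (auto simp: pgf_poisson)

context colour_family
begin

text \<open>The lower bound for \<open>1 - B i j\<close> supplied by \<open>B_upper\<close>, so that
  \<open>d * T\<close> is the decay exponent of the next level.\<close>

definition T where "T = (1 - 2 * x - 4 * x / (k - 1)) / (k - 1)"

context
  fixes \<xi> d assumes \<xi>: "poisson_like \<xi> d"
begin

lemma pgf_B_le:
  assumes "i \<in> K" "j \<in> K" "i \<noteq> j" shows "pgf \<xi> (B i j) \<le> exp (- d * T)"
proof -
  have "0 \<le> B i j" using k2 by (intro order.trans[OF _ B_lower[OF assms(1,2)]]) auto
  then have "pgf \<xi> (B i j) \<le> exp (- d * (1 - B i j))"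
    using \<xi> B_le_1[OF assms(1,2)] by (simp add: poisson_like_def)
  also have "\<dots> \<le> exp (- d * T)"
  proof -
    have "T \<le> 1 - B i j" using B_upper[OF assms] by (simp add: T_def)
    then have "d * T \<le> d * (1 - B i j)" using \<xi> by (intro mult_left_mono) (auto simp: poisson_like_def)
    then show ?thesis by simp
  qed
  finally show ?thesis .
qed

lemma x'_le_trivial: "x' \<xi> \<le> (k - 1) / 2 * exp (- d * T)"
proof (rule x'_le)
  fix i j assume ij: "i \<in> K" "j \<in> K" "i \<noteq> j"
  have "0 \<le> total (\<lambda>os. lw \<xi> i os * lw \<xi> j os / (lw \<xi> i os + lw \<xi> j os))"
    using ij lw_nonneg by (intro Bochner_Integration.integral_nonneg) auto
  then show "pgf \<xi> (B i j) - total (\<lambda>os. lw \<xi> i os * lw \<xi> j os / (lw \<xi> i os + lw \<xi> j os)) / 20 \<le> exp (- d * T)"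
    using pgf_B_le[OF ij] by linarith
qed

text \<open>The hypothesis on \<open>E\<close> bounds the generating functions at \<open>B\<close>,
  \<open>QG i j\<close> and \<open>QG j i\<close> by \<open>exp E\<close> times the one at
  \<open>BG\<close>. The harmonic term is then at least a fixed fraction
  \<open>exp (- 2 * E) / 2\<close> of the Bhattacharyya coefficient, and its twentieth is the
  gain.\<close>

lemma x'_le_gain:
  assumes "x \<le> 1" "35 \<le> k" and E: "32 * d * x / (k - 1) \<le> E"
  shows "x' \<xi> \<le> (k - 1) / 2 * (exp (- d * T) * (1 - exp (- 2 * E) / 40))"
proof (rule x'_le)
  fix i j assume ij: "i \<in> K" "j \<in> K" "i \<noteq> j"
  have d: "0 \<le> d" using \<xi> by (simp add: poisson_like_def)
  \<comment> \<open>Only an upper bound on \<open>t - s\<close> is available; for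
    \<open>t < s\<close> monotonicity takes over. The growth exponent
    \<open>2 * d * (16 * x / (k - 1))\<close> is the quantity bounded by \<open>E\<close>.\<close>
  have grow: "pgf \<xi> t \<le> exp E * pgf \<xi> s" if "1/2 \<le> s" and s1: "s \<le> 1" and "t \<le> 1" "0 \<le> t" "t - s \<le> 16 * x / (k - 1)" for s t
  proof (cases "s \<le> t")
    case True
    have "pgf \<xi> t \<le> exp (2 * d * (t - s)) * pgf \<xi> s" using \<xi> that True by (auto simp: poisson_like_def)
    also have "2 * d * (t - s) \<le> 2 * d * (16 * x / (k - 1))" using that d by (intro mult_left_mono) auto
    then have "exp (2 * d * (t - s)) * pgf \<xi> s \<le> exp E * pgf \<xi> s"
      using E that by (intro mult_right_mono pgf_nonneg) auto
    finally show ?thesis .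
  next
    case False
    have "0 \<le> E" by (rule order.trans[OF _ E]) (use d x_nonneg k2 in auto)
    then have "1 * pgf \<xi> s \<le> exp E * pgf \<xi> s" using that by (intro mult_right_mono pgf_nonneg) auto
    moreover have "pgf \<xi> t \<le> pgf \<xi> s"
      using False that s1 by (intro pgf_mono) auto
    ultimately show ?thesis by simp
  qed
  have BG: "1/2 \<le> BG i j"
  proof -
    have "16 * x / (k - 1) \<le> 16 / (k - 1)" using assms by (intro divide_right_mono) auto
    then have "BG i j \<ge> (k - 2) / (k - 1) - 16 / (k - 1)"
      using B_lower[OF ij(1,2)] B_minus_BG[OF ij(1,2)] by linarith
    \<comment> \<open>This is \<open>k - 18 \<ge> (k - 1) / 2\<close>, the origin of the condition
      \<open>35 \<le> k\<close>.\<close>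
    moreover have "(k - 2) / (k - 1) - 16 / (k - 1) \<ge> 1/2"
      unfolding diff_divide_distrib[symmetric] using assms by (simp add: pos_le_divide_eq)
    ultimately show ?thesis by linarith
  qed
  have QG0: "0 \<le> QG i' j'" if "i' \<in> K" for i' j'
    unfolding QG_def using q_nonneg[OF that] G_nonneg by (intro Bochner_Integration.integral_nonneg) auto
  have BGji: "BG j i = BG i j" unfolding BG_def by (simp add: G_commute[of j i] mult.commute)
  have BG1: "BG i j \<le> 1" using BG_le_B[OF ij(1,2)] B_le_1[OF ij(1,2)] by linarith
  define g where "g = pgf \<xi> (BG i j)"
  have g: "0 \<le> g" unfolding g_def using BG by (intro pgf_nonneg) auto
  have gB: "pgf \<xi> (B i j) \<le> exp E * g" unfolding g_def
    using BG BG1 B_minus_BG[OF ij(1,2)] B_le_1[OF ij(1,2)] BG_le_B[OF ij(1,2)] by (intro grow) auto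
  have gQ: "pgf \<xi> (QG i j) \<le> exp E * g" unfolding g_def
    using BG BG1 QG_minus_BG[OF ij(1,2)] QG_le_1[OF ij(1)] QG0[OF ij(1)] by (intro grow) auto
  have gQ': "pgf \<xi> (QG j i) \<le> exp E * g" unfolding g_def
    using BG BG1 QG_minus_BG[OF ij(2,1)] QG_le_1[OF ij(2)] QG0[OF ij(2)] by (intro grow) (auto simp: BGji)
  let ?H = "total (\<lambda>os. lw \<xi> i os * lw \<xi> j os / (lw \<xi> i os + lw \<xi> j os))"
  \<comment> \<open>The maximiser of \<open>2 * t * g - 2 * t\<^sup>2 * exp E * g\<close>.\<close>
  define t where "t = exp (- E) / 2"
  have "g * exp (- E) / 2 = 2 * t * g - t\<^sup>2 * (exp E * g + exp E * g)"
    by (simp add: t_def power2_eq_square exp_minus field_simps)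
  also have "\<dots> \<le> 2 * t * g - t\<^sup>2 * (pgf \<xi> (QG i j) + pgf \<xi> (QG j i))"
    using gQ gQ' by (intro diff_left_mono mult_left_mono add_mono) auto
  also have "\<dots> \<le> ?H" unfolding g_def by (rule total_harmonic_lw_ge[OF ij(1,2)])
  finally have H: "g * exp (- E) / 2 \<le> ?H" .
  have "pgf \<xi> (B i j) * (exp (- 2 * E) / 2) \<le> exp E * g * (exp (- 2 * E) / 2)"
    using gB by (intro mult_right_mono) auto
  also have "\<dots> = g * exp (- E) / 2"
    by (simp add: exp_minus exp_double field_simps power2_eq_square flip: exp_add)
  finally have "pgf \<xi> (B i j) * (exp (- 2 * E) / 2) \<le> ?H" using H by linarith
  then have "pgf \<xi> (B i j) - ?H / 20 \<le> pgf \<xi> (B i j) * (1 - exp (- 2 * E) / 40)" by (simp add: algebra_simps)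
  also have "\<dots> \<le> exp (- d * T) * (1 - exp (- 2 * E) / 40)"
  proof (intro mult_right_mono pgf_B_le ij)
    have "0 \<le> E" by (rule order.trans[OF _ E]) (use d x_nonneg k2 in auto)
    then have "exp (- 2 * E) \<le> 1" by simp
    then show "0 \<le> 1 - exp (- 2 * E) / 40" by linarith
  qed
  finally show "pgf \<xi> (B i j) - ?H / 20 \<le> exp (- d * T) * (1 - exp (- 2 * E) / 40)" .
qed

end

end

section \<open>Observations\<close>

lemma total_inj:
  fixes f :: "'b \<Rightarrow> real"
  assumes "inj g" "\<And>y. y \<notin> range g \<Longrightarrow> f y = 0" shows "total f = total (\<lambda>y. f (g y))"
  using infsetsum_reindex[of g UNIV f] infsetsum_cong_neutral[of "range g" UNIV f f] assms
  by (auto simp: infsetsum_def)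

text \<open>Tree shape and deepest colours in one object, split at the root. A vertex that dies out
  earlier is \<open>Node []\<close>, which is distinct from a coloured leaf.\<close>

datatype 'c obs = Leaf 'c | Node "'c obs list"

lemma inj_Node: "inj Node" by (simp add: inj_on_def)

lemma pmf_replicate_pmf:
  "pmf (replicate_pmf n p) xs = (if length xs = n then prod_list (map (pmf p) xs) else 0)"
proof (induction n arbitrary: xs)
  case (Suc n)
  have *: "replicate_pmf (Suc n) p = map_pmf (\<lambda>(x, xs). x # xs) (pair_pmf p (replicate_pmf n p))"
    by (simp add: pair_pmf_def map_pmf_def bind_assoc_pmf bind_return_pmf)
  show ?case
  proof (cases xs)
    case Nil
    then show ?thesis unfolding * by (auto simp: pmf_eq_0_set_pmf)
  next
    case (Cons y ys)
    have "inj (\<lambda>(x, xs). x # xs)" by (auto simp: inj_on_def)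
    from pmf_map_inj'[OF this, of "pair_pmf p (replicate_pmf n p)" "(y, ys)"]
    show ?thesis unfolding * by (simp add: Cons pmf_pair Suc)
  qed
qed (auto simp: pmf_return)

lemma replicate_pmf_map: "replicate_pmf n (map_pmf f p) = map_pmf (map f) (replicate_pmf n p)"
  by (induction n) (simp_all add: map_pmf_def bind_assoc_pmf bind_return_pmf)

text \<open>
  Joint law of the first \<open>n\<close> levels of the Galton-Watson tree and the colours at level \<open>n\<close>, given
  the root colour.
\<close>

primrec obs_pmf :: "'c set \<Rightarrow> nat pmf \<Rightarrow> nat \<Rightarrow> 'c \<Rightarrow> 'c obs pmf" where
  "obs_pmf K \<xi> 0 i = return_pmf (Leaf i)"
| "obs_pmf K \<xi> (Suc n) i =
     bind_pmf \<xi> (\<lambda>D. map_pmf Node (replicate_pmf D (bind_pmf (pmf_of_set (K - {i})) (obs_pmf K \<xi> n))))"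

lemma pmf_obs_Node:
  "pmf (obs_pmf K \<xi> (Suc n) i) (Node os)
     = pmf \<xi> (length os) * prod_list (map (pmf (bind_pmf (pmf_of_set (K - {i})) (obs_pmf K \<xi> n))) os)"
proof -
  let ?Q = "bind_pmf (pmf_of_set (K - {i})) (obs_pmf K \<xi> n)"
  have "pmf (obs_pmf K \<xi> (Suc n) i) (Node os) = (\<integral>D. pmf (map_pmf Node (replicate_pmf D ?Q)) (Node os) \<partial>measure_pmf \<xi>)"
    by (simp add: pmf_bind)
  also have "\<dots> = (\<integral>D. prod_list (map (pmf ?Q) os) * indicator {length os} D \<partial>measure_pmf \<xi>)"
    by (intro Bochner_Integration.integral_cong) (auto simp: pmf_map_inj'[OF inj_Node] pmf_replicate_pmf)
  also have "\<dots> = prod_list (map (pmf ?Q) os) * pmf \<xi> (length os)"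
    by (simp add: measure_pmf_single)
  finally show ?thesis by simp
qed

lemma pmf_obs_Leaf: "pmf (obs_pmf K \<xi> (Suc n) i) (Leaf c) = 0"
  by (auto simp: pmf_eq_0_set_pmf)

lemma obs_pmf_permute:
  assumes \<pi>: "\<pi> permutes K" and K: "finite K" "2 \<le> card K"
  shows "i \<in> K \<Longrightarrow> obs_pmf K \<xi> n (\<pi> i) = map_pmf (map_obs \<pi>) (obs_pmf K \<xi> n i)"
proof (induction n arbitrary: i)
  case (Suc n)
  have inj: "inj \<pi>" using \<pi> by (rule permutes_inj)
  have "K - {i} \<noteq> {}"
  proof
    assume "K - {i} = {}"
    then have "card K \<le> card {i}" by (intro card_mono) auto
    then show False using K by simp
  qed
  have "K - {\<pi> i} = \<pi> ` (K - {i})"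
    using permutes_image[OF \<pi>] inj by (auto simp: image_set_diff)
  then have "pmf_of_set (K - {\<pi> i}) = map_pmf \<pi> (pmf_of_set (K - {i}))"
    using K \<open>K - {i} \<noteq> {}\<close> inj by (simp add: map_pmf_of_set_inj inj_on_subset)
  then have "bind_pmf (pmf_of_set (K - {\<pi> i})) (obs_pmf K \<xi> n)
      = bind_pmf (pmf_of_set (K - {i})) (\<lambda>j. obs_pmf K \<xi> n (\<pi> j))"
    by (simp add: bind_map_pmf)
  also have "\<dots> = bind_pmf (pmf_of_set (K - {i})) (\<lambda>j. map_pmf (map_obs \<pi>) (obs_pmf K \<xi> n j))"
    using K \<open>K - {i} \<noteq> {}\<close> by (intro bind_pmf_cong refl Suc.IH) simp
  also have "\<dots> = map_pmf (map_obs \<pi>) (bind_pmf (pmf_of_set (K - {i})) (obs_pmf K \<xi> n))"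
    by (simp add: map_bind_pmf)
  finally have Q: "bind_pmf (pmf_of_set (K - {\<pi> i})) (obs_pmf K \<xi> n)
      = map_pmf (map_obs \<pi>) (bind_pmf (pmf_of_set (K - {i})) (obs_pmf K \<xi> n))" .
  show ?case
    unfolding obs_pmf.simps Q replicate_pmf_map by (simp add: map_bind_pmf pmf.map_comp o_def)
qed simp

lemma bij_map_obs:
  assumes "bij \<pi>" shows "bij (map_obs \<pi>)"
proof -
  have *: "\<pi> \<circ> inv \<pi> = id" "inv \<pi> \<circ> \<pi> = id"
    using assms by (auto simp: bij_def surj_iff)
  have "map_obs \<pi> \<circ> map_obs (inv \<pi>) = id" "map_obs (inv \<pi>) \<circ> map_obs \<pi> = id"
    by (rule ext, simp add: obs.map_comp * obs.map_id)+
  then show ?thesis by (intro o_bij)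
qed

lemma colour_family_obs:
  assumes "finite K" "2 \<le> card K" shows "colour_family K (obs_pmf K \<xi> n)"
proof
  fix \<pi> assume "\<pi> permutes K"
  then show "\<exists>g. bij g \<and> (\<forall>i\<in>K. obs_pmf K \<xi> n (\<pi> i) = map_pmf g (obs_pmf K \<xi> n i))"
    using obs_pmf_permute[OF _ assms] bij_map_obs permutes_bij by blast
qed (use assms in auto)

context
  fixes K :: "'c set" and \<xi> :: "nat pmf"
  assumes K: "finite K" "2 \<le> card K"
begin

interpretation C: colour_family K "obs_pmf K \<xi> n" for n
  by (rule colour_family_obs[OF K])

lemma pmf_obs_Node_lw:
  assumes "i \<in> K" shows "pmf (obs_pmf K \<xi> (Suc n) i) (Node os) = C.lw n \<xi> i os"
proof -
  have "pmf (bind_pmf (pmf_of_set (K - {i})) (obs_pmf K \<xi> n)) y = C.q n i y" for y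
  proof -
    have "K - {i} \<noteq> {}"
    proof
      assume "K - {i} = {}"
      then have "card K \<le> card {i}" by (intro card_mono) auto
      then show False using K by simp
    qed
    then have "pmf (bind_pmf (pmf_of_set (K - {i})) (obs_pmf K \<xi> n)) y
        = (\<Sum>j\<in>K - {i}. pmf (obs_pmf K \<xi> n j) y) / real (card (K - {i}))"
      using K by (simp add: pmf_bind_pmf_of_set)
    then show ?thesis using K assms
      by (simp add: C.q_def C.S_def C.p_def C.k_def sum_diff1 of_nat_diff)
  qed
  then have "pmf (bind_pmf (pmf_of_set (K - {i})) (obs_pmf K \<xi> n)) = C.q n i" by (intro ext)
  then show ?thesis by (simp only: pmf_obs_Node C.lw_def)
qed

text \<open>After one step the \<open>Leaf\<close> observations have probability zero, which is why
  \<open>F\<close> has to vanish at zero; the others are indexed by the lists below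
  \<open>Node\<close>. \<open>F\<close> may look only at colours in \<open>K\<close>, where
  \<open>lw\<close> is the density.\<close>

lemma total_obs_Suc:
  assumes F: "F (\<lambda>i. 0) = 0" "\<And>r r'. (\<And>i. i \<in> K \<Longrightarrow> r i = r' i) \<Longrightarrow> F r = F r'"
  shows "total (\<lambda>y. F (\<lambda>i. pmf (obs_pmf K \<xi> (Suc n) i) y)) = total (\<lambda>os. F (\<lambda>i. C.lw n \<xi> i os))"
proof -
  have "total (\<lambda>y. F (\<lambda>i. pmf (obs_pmf K \<xi> (Suc n) i) y))
      = total (\<lambda>os. F (\<lambda>i. pmf (obs_pmf K \<xi> (Suc n) i) (Node os)))"
  proof (rule total_inj[OF inj_Node])
    fix y :: "'c obs" assume "y \<notin> range Node"
    then obtain c where "y = Leaf c" by (cases y) auto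
    then show "F (\<lambda>i. pmf (obs_pmf K \<xi> (Suc n) i) y) = 0"
      by (simp only: pmf_obs_Leaf F(1))
  qed
  moreover have "F (\<lambda>i. pmf (obs_pmf K \<xi> (Suc n) i) (Node os)) = F (\<lambda>i. C.lw n \<xi> i os)" for os
    by (rule F(2)) (rule pmf_obs_Node_lw)
  ultimately show ?thesis by (simp only:)
qed

lemma x_Suc: "C.x (Suc n) = C.x' n \<xi>"
proof -
  have "total (\<lambda>y. loss K (\<lambda>i. pmf (obs_pmf K \<xi> (Suc n) i) y)) = total (\<lambda>os. loss K (\<lambda>i. C.lw n \<xi> i os))"
  proof (rule total_obs_Suc)
    show "loss K (\<lambda>i. 0) = 0" using K by (intro loss_zero) auto
    show "loss K r = loss K r'" if "\<And>i. i \<in> K \<Longrightarrow> r i = r' i" for r r' :: "'c \<Rightarrow> real"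
      using that unfolding loss_def by (simp cong: sum.cong)
  qed
  then show ?thesis unfolding C.x_def C.x'_def C.p_def C.k_def by (simp only:)
qed

lemma x_0: "C.x 0 = 0"
proof -
  have "loss K (\<lambda>i. pmf (obs_pmf K \<xi> 0 i) y) = 0" for y
  proof (cases "\<exists>c\<in>K. y = Leaf c")
    case True
    then obtain c where c: "c \<in> K" "y = Leaf c" by blast
    define r :: "'c \<Rightarrow> real" where "r i = (if i = c then 1 else 0)" for i
    have "(\<lambda>i. pmf (obs_pmf K \<xi> 0 i) y) = r" by (auto simp: c r_def fun_eq_iff pmf_return)
    moreover have "sum r K = 1" using c K by (simp add: r_def)
    moreover have "(\<Sum>l\<in>K. sqrt (1 - r l)) = real (card K) - 1"
    proof -
      have "(\<Sum>l\<in>K. sqrt (1 - r l)) = (\<Sum>l\<in>K. 1 - r l)" by (intro sum.cong) (auto simp: r_def)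
      then show ?thesis using \<open>sum r K = 1\<close> by (simp add: sum_subtractf)
    qed
    ultimately show ?thesis by (simp add: loss_def)
  next
    case False
    then have "pmf (obs_pmf K \<xi> 0 i) y = 0" if "i \<in> K" for i using that by (auto simp: pmf_return)
    then show ?thesis using K by (intro loss_zero) auto
  qed
  then show ?thesis unfolding C.x_def C.p_def by simp
qed

lemma bhattacharyya_Suc:
  assumes "i \<in> K" "j \<in> K"
  shows "total (\<lambda>y. sqrt (pmf (obs_pmf K \<xi> (Suc n) i) y * pmf (obs_pmf K \<xi> (Suc n) j) y)) = pgf \<xi> (C.B n i j)"
  using total_obs_Suc[of "\<lambda>r. sqrt (r i * r j)" n] assms C.total_sqrt_lw(2)[OF assms] by simp

end

text \<open>The witness is the event that \<open>P\<close> is at least as likely as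
  \<open>Q\<close>. Pointwise, \<open>P - sqrt (P * Q)\<close> is at most the positive part of
  \<open>P - Q\<close>, because the geometric mean lies above the smaller of the two.\<close>

lemma prob_diff_ge_bhattacharyya:
  fixes P Q :: "'a pmf"
  obtains A where "1 - total (\<lambda>y. sqrt (pmf P y * pmf Q y)) \<le> measure_pmf.prob P A - measure_pmf.prob Q A"
proof -
  define A where "A = {y. pmf Q y \<le> pmf P y}"
  have int: "integrable (count_space UNIV) (\<lambda>y. pmf M y * indicator A y)" for M :: "'a pmf"
    by (rule Bochner_Integration.integrable_bound[OF integrable_pmf[of UNIV M]]) (auto simp: indicator_def)
  have prob: "measure_pmf.prob M A = total (\<lambda>y. pmf M y * indicator A y)" for M :: "'a pmf"
    unfolding integral_pmf[symmetric]
    using infsetsum_altdef[of "pmf M" A] unfolding infsetsum_def set_lebesgue_integral_def by (simp add: mult.commute)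
  have ints: "integrable (count_space UNIV) (\<lambda>y. sqrt (pmf P y * pmf Q y))"
  proof (rule Bochner_Integration.integrable_bound)
    show "integrable (count_space UNIV) (\<lambda>y. (pmf P y + pmf Q y) / 2)"
      by (intro integrable_divide Bochner_Integration.integrable_add integrable_pmf)
    show "AE y in count_space UNIV. norm (sqrt (pmf P y * pmf Q y)) \<le> norm ((pmf P y + pmf Q y) / 2)"
    proof (rule AE_I2)
      fix y
      show "norm (sqrt (pmf P y * pmf Q y)) \<le> norm ((pmf P y + pmf Q y) / 2)"
        using arith_geo_mean_sqrt[of "pmf P y" "pmf Q y"] by simp
    qed
  qed simp
  have "1 - total (\<lambda>y. sqrt (pmf P y * pmf Q y)) = total (\<lambda>y. pmf P y - sqrt (pmf P y * pmf Q y))"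
    using ints by (simp add: integrable_pmf integral_pmf)
  also have "\<dots> \<le> total (\<lambda>y. pmf P y * indicator A y - pmf Q y * indicator A y)"
  proof (rule integral_mono)
    fix y
    have "pmf Q y \<le> sqrt (pmf P y * pmf Q y)" if "pmf Q y \<le> pmf P y"
      using that by (intro real_le_rsqrt) (auto simp: power2_eq_square intro: mult_right_mono)
    moreover have "pmf P y \<le> sqrt (pmf P y * pmf Q y)" if "pmf P y \<le> pmf Q y"
      using that by (intro real_le_rsqrt) (auto simp: power2_eq_square intro: mult_left_mono)
    ultimately show "pmf P y - sqrt (pmf P y * pmf Q y) \<le> pmf P y * indicator A y - pmf Q y * indicator A y"
      by (auto simp: A_def indicator_def)
  qed (intro Bochner_Integration.integrable_diff int ints integrable_pmf)+
  also have "\<dots> = measure_pmf.prob P A - measure_pmf.prob Q A"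
    unfolding prob using int by simp
  finally show thesis by (rule that)
qed

section \<open>The invariant\<close>

text \<open>Far above the threshold the exponential is of order \<open>1 / k\<^sup>2\<close>, so the
  invariant survives without the constant-factor gain.\<close>

lemma contraction_large_rate:
  fixes k L d T :: real
  assumes "0 < k" "0 < L" "exp L = k" "exp 3 * L \<le> k" "2 * L - 3 \<le> d * T"
  shows "(k - 1) / 2 * exp (- d * T) \<le> 1 / (2 * L)"
proof -
  have "(k - 1) / 2 * exp (- d * T) \<le> k / 2 * exp (3 - 2 * L)"
    using assms by (intro mult_mono) auto
  also have "exp (3 - 2 * L) = exp 3 / k\<^sup>2"
    using assms(3) by (simp add: exp_diff exp_double)
  also have "k / 2 * (exp 3 / k\<^sup>2) = exp 3 / (2 * k)" using assms by (simp add: power2_eq_square)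
  also have "\<dots> \<le> 1 / (2 * L)" using assms by (simp add: field_simps)
  finally show ?thesis .
qed

text \<open>The budget is \<open>exp \<epsilon> * (1 - \<epsilon>) \<le> 1\<close>: a gain of
  \<open>\<epsilon>\<close> tolerates an exponent short by \<open>\<epsilon>\<close>. One half of it
  lowers the threshold constant below 1, the other half absorbs the error \<open>r\<close>.\<close>

lemma contraction_moderate_rate:
  fixes k L d T \<epsilon> r :: real
  assumes "0 < k" "0 < L" "exp L = k" "0 < \<epsilon>" "\<epsilon> \<le> 1" "r \<le> \<epsilon> / 2"
    "L + ln L + (1 - \<epsilon> / 2) - 1 - r \<le> d * T"
  shows "(k - 1) / 2 * (exp (- d * T) * (1 - \<epsilon>)) \<le> 1 / (2 * L)"
proof -
  have "exp (- d * T) \<le> exp (\<epsilon> - L - ln L)" using assms by simp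
  also have "\<dots> = exp \<epsilon> / (k * L)" using assms by (simp add: exp_diff)
  finally have "exp (- d * T) * (1 - \<epsilon>) \<le> exp \<epsilon> / (k * L) * exp (- \<epsilon>)"
    using assms exp_ge_add_one_self[of "- \<epsilon>"] by (intro mult_mono) auto
  then have e: "exp (- d * T) * (1 - \<epsilon>) \<le> 1 / (k * L)" by (simp add: exp_minus)
  have "(k - 1) / 2 * (exp (- d * T) * (1 - \<epsilon>)) \<le> k / 2 * (1 / (k * L))"
    using assms by (intro mult_mono e) auto
  then show ?thesis using assms by simp
qed

text \<open>\<open>T\<close> as produced by the one-step bound, under the invariant \<open>x \<le> 1 / (2 L)\<close>.\<close>

lemma rate_bounds:
  fixes k L d x \<beta> :: real
  defines "T \<equiv> (1 - 2 * x - 4 * x / (k - 1)) / (k - 1)"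
  assumes k: "35 \<le> k" "8 \<le> L" and x: "0 \<le> x" "x \<le> 1 / (2 * L)" and \<beta>: "0 \<le> \<beta>" "\<beta> \<le> 1"
  shows "2 * k * L \<le> d \<Longrightarrow> 2 * L - 3 \<le> d * T"
    and "k * (L + ln L + \<beta>) \<le> d \<Longrightarrow>
      L + ln L + \<beta> - 1 - ((ln L + 1) / L + 2 * (L + ln L + 1) / (L * (k - 1))) \<le> d * T"
proof -
  \<comment> \<open>The numerator of \<open>T\<close> at the extreme value
    \<open>x = 1 / (2 * L)\<close>. The denominator \<open>k - 1\<close> is relaxed to
    \<open>k\<close> to match the form of the hypotheses on \<open>d\<close>.\<close>
  define \<tau> where "\<tau> = 1 - 1 / L - 2 / (L * (k - 1))"
  have "2 / (L * (k - 1)) \<le> 2 / L" using k by (intro divide_left_mono) auto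
  moreover have "3 / L \<le> 1" using k by simp
  ultimately have \<tau>0: "0 \<le> \<tau>" unfolding \<tau>_def by (simp add: diff_divide_distrib[symmetric] add_divide_distrib[symmetric])
  have "4 * x / (k - 1) \<le> 4 * (1 / (2 * L)) / (k - 1)"
    using x k by (intro divide_right_mono mult_left_mono) auto
  then have "4 * x / (k - 1) \<le> 2 / (L * (k - 1))" by simp
  moreover have "2 * x \<le> 1 / L" using x k by (simp add: field_simps)
  ultimately have \<tau>: "\<tau> \<le> 1 - 2 * x - 4 * x / (k - 1)" unfolding \<tau>_def by linarith
  have T: "\<tau> / k \<le> T"
    unfolding T_def using \<tau> \<tau>0 k by (intro frac_le) auto
  have *: "c * \<tau> \<le> d * T" if "k * c \<le> d" "0 \<le> c" for c
  proof -
    have "c * \<tau> = (k * c) * (\<tau> / k)" using k by simp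
    also have "\<dots> \<le> d * T"
    proof (rule mult_mono)
      show "0 \<le> d" by (rule order.trans[OF _ that(1)]) (use that k in simp)
    qed (use that T \<tau>0 k in auto)
    finally show ?thesis .
  qed
  show "2 * L - 3 \<le> d * T" if "2 * k * L \<le> d"
  proof -
    have "2 * L * \<tau> = 2 * L - 2 - 4 / (k - 1)" using k by (simp add: \<tau>_def field_simps)
    moreover have "4 / (k - 1) \<le> 1" using k by simp
    moreover have "2 * L * \<tau> \<le> d * T" using that k by (intro *) (auto simp: mult_ac)
    ultimately show ?thesis by linarith
  qed
  show "L + ln L + \<beta> - 1 - ((ln L + 1) / L + 2 * (L + ln L + 1) / (L * (k - 1))) \<le> d * T"
    if "k * (L + ln L + \<beta>) \<le> d"
  proof -
    define c where "c = L + ln L + \<beta>"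
    have "0 \<le> ln L" using k by simp
    \<comment> \<open>The leading 1 of this quotient is the price of
      \<open>2 * x \<le> 1 / L\<close> at degree about \<open>k * L\<close>, hence the
      \<open>- 1\<close> next to \<open>\<beta>\<close>; the remainder vanishes as \<open>k\<close>
      grows.\<close>
    have "c / L \<le> (L + ln L + 1) / L" unfolding c_def using \<beta> k by (intro divide_right_mono) auto
    moreover have "(L + ln L + 1) / L = 1 + (ln L + 1) / L" using k by (simp add: add_divide_distrib)
    moreover have "2 * c / (L * (k - 1)) \<le> 2 * (L + ln L + 1) / (L * (k - 1))"
      unfolding c_def using \<beta> k by (intro divide_right_mono) auto
    moreover have "c * \<tau> = c - c / L - 2 * c / (L * (k - 1))" by (simp add: \<tau>_def algebra_simps)
    moreover have "c * \<tau> \<le> d * T" using * that \<open>0 \<le> ln L\<close> \<beta> k by (auto simp: c_def)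
    ultimately show ?thesis unfolding c_def by linarith
  qed
qed


text \<open>The constant comes from \<open>x'_le_gain\<close> with \<open>E = 64\<close>.\<close>

definition gain :: real where "gain = exp (- 128) / 40"

lemma gain_bounds: "0 < gain" "gain \<le> 1" by (auto simp: gain_def intro: order.trans[of _ 1])

text \<open>The bound 35 keeps the mass on \<open>G\<close> above 1/2, and 8 keeps the rate
  positive. The third condition serves the large-degree case, and the last is the error term of
  \<open>rate_bounds\<close>, which may use up half of the gain.\<close>

definition large_enough :: "nat \<Rightarrow> bool" where
  "large_enough k \<longleftrightarrow> 35 \<le> real k \<and> 8 \<le> ln (real k) \<and> exp 3 * ln (real k) \<le> real k \<and>
     (ln (ln (real k)) + 1) / ln (real k)
       + 2 * (ln (real k) + ln (ln (real k)) + 1) / (ln (real k) * (real k - 1)) \<le> gain / 2"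

context
  fixes K :: "'c set" and \<xi> d L
  defines "L \<equiv> ln (real (card K))"
  assumes K: "finite K" and large: "large_enough (card K)" and \<xi>: "poisson_like \<xi> d"
    and d: "real (card K) * (L + ln L + (1 - gain / 2)) \<le> d"
begin

lemma card_bounds: "35 \<le> real (card K)" "8 \<le> L" "exp L = real (card K)" "exp 3 * L \<le> real (card K)"
  using large by (auto simp: large_enough_def L_def)

lemma error_le: "(ln L + 1) / L + 2 * (L + ln L + 1) / (L * (real (card K) - 1)) \<le> gain / 2"
  using large unfolding large_enough_def L_def by blast

interpretation C: colour_family K "obs_pmf K \<xi> n" for n
  by (rule colour_family_obs[OF K]) (use card_bounds in simp)

lemma C_k: "C.k = real (card K)" by (simp add: C.k_def)

lemma rate_lower:
  assumes "C.x n \<le> 1 / (2 * L)"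
  shows "2 * real (card K) * L \<le> d \<Longrightarrow> 2 * L - 3 \<le> d * C.T n"
    and "L + ln L + (1 - gain / 2) - 1 - ((ln L + 1) / L + 2 * (L + ln L + 1) / (L * (real (card K) - 1))) \<le> d * C.T n"
  using rate_bounds[OF card_bounds(1,2) C.x_nonneg assms, of "1 - gain / 2" d] d gain_bounds
  by (simp_all add: C.T_def C_k)

lemma x_invariant: "C.x n \<le> 1 / (2 * L)"
proof (induction n)
  case 0
  have "2 \<le> card K" using card_bounds by simp
  then show ?case unfolding x_0[OF K \<open>2 \<le> card K\<close>] using card_bounds by simp
next
  case (Suc n)
  have card: "2 \<le> card K" using card_bounds by simp
  have "C.x' n \<xi> \<le> 1 / (2 * L)"
  \<comment> \<open>The gain depends on \<open>d * x / k\<close>, which the invariant bounds only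
    when \<open>d\<close> is at most of order \<open>k * L\<close>.\<close>
  proof (cases "2 * real (card K) * L \<le> d")
    case True
    have "C.x' n \<xi> \<le> (real (card K) - 1) / 2 * exp (- d * C.T n)"
      using C.x'_le_trivial[OF \<xi>] by (simp add: C_k)
    also have "\<dots> \<le> 1 / (2 * L)"
      by (rule contraction_large_rate) (use card_bounds rate_lower(1)[OF Suc True] in auto)
    finally show ?thesis .
  next
    case False
    have "C.x n \<le> 1" by (rule order.trans[OF Suc]) (use card_bounds in simp)
    \<comment> \<open>This yields \<open>d * x \<le> k\<close>, and
      \<open>32 * k \<le> 64 * (k - 1)\<close> gives \<open>E = 64\<close>.\<close>
    have "d * C.x n \<le> (2 * real (card K) * L) * (1 / (2 * L))"
      by (rule mult_mono) (use False Suc card_bounds C.x_nonneg in auto)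
    also have "\<dots> = real (card K)" using card_bounds by simp
    finally have "32 * d * C.x n \<le> 32 * real (card K)" by simp
    also have "\<dots> \<le> 64 * (real (card K) - 1)" using card_bounds by simp
    finally have "32 * d * C.x n / (C.k - 1) \<le> 64" using card_bounds by (simp add: C_k divide_le_eq)
    from C.x'_le_gain[OF \<xi> \<open>C.x n \<le> 1\<close> _ this]
    have "C.x' n \<xi> \<le> (real (card K) - 1) / 2 * (exp (- d * C.T n) * (1 - gain))"
      using card_bounds by (simp add: C_k gain_def)
    also have "\<dots> \<le> 1 / (2 * L)"
      by (rule contraction_moderate_rate[OF _ _ card_bounds(3) gain_bounds error_le rate_lower(2)[OF Suc]]) (use card_bounds in auto)
    finally show ?thesis .
  qed
  then show ?case unfolding x_Suc[OF K card] .
qed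

lemma obs_pmf_distinguishable:
  assumes ij: "i \<in> K" "j \<in> K" "i \<noteq> j"
  shows "\<exists>A. 1 / 2 \<le> measure_pmf.prob (obs_pmf K \<xi> n i) A - measure_pmf.prob (obs_pmf K \<xi> n j) A"
proof (cases n)
  case 0
  show ?thesis by (rule exI[of _ "{Leaf i}"]) (use ij 0 in simp)
next
  case (Suc m)
  have card: "2 \<le> card K" using card_bounds by simp
  have "0 \<le> ln L" using card_bounds by simp
  \<comment> \<open>The exponent is at least \<open>L + ln L - gain\<close>, with
    \<open>L \<ge> 8\<close>. The resulting coefficient of at most \<open>exp (- 1)\<close>, below
    1/2, is uniform in the level.\<close>
  then have "1 \<le> d * C.T m"
    using rate_lower(2)[OF x_invariant, of m] error_le gain_bounds card_bounds(2) by linarith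
  then have "exp (- d * C.T m) \<le> exp (- 1)" by simp
  also have "\<dots> \<le> 1 / 2" using exp_ge_add_one_self[of 1] by (simp add: exp_minus field_simps)
  finally have "total (\<lambda>y. sqrt (pmf (obs_pmf K \<xi> n i) y * pmf (obs_pmf K \<xi> n j) y)) \<le> 1 / 2"
    unfolding Suc bhattacharyya_Suc[OF K card ij(1,2)] using C.pgf_B_le[OF \<xi> ij, of m] by linarith
  moreover obtain A where "1 - total (\<lambda>y. sqrt (pmf (obs_pmf K \<xi> n i) y * pmf (obs_pmf K \<xi> n j) y))
      \<le> measure_pmf.prob (obs_pmf K \<xi> n i) A - measure_pmf.prob (obs_pmf K \<xi> n j) A"
    by (rule prob_diff_ge_bhattacharyya)
  ultimately show ?thesis by (intro exI[of _ A]) linarith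
qed

end

section \<open>The colouring model as a branching recursion\<close>

text \<open>Independent but not identically distributed entries: in a fixed tree the subtrees at the
  children of the root may differ.\<close>

primrec list_product_pmf :: "'a pmf list \<Rightarrow> 'a list pmf" where
  "list_product_pmf [] = return_pmf []"
| "list_product_pmf (p # ps) = map_pmf (\<lambda>(x, xs). x # xs) (pair_pmf p (list_product_pmf ps))"

text \<open>A kernel that acts separately on each branch preserves independence of the
  branches.\<close>

lemma list_product_pmf_bind:
  "bind_pmf (list_product_pmf (map p cs)) (\<lambda>xs. list_product_pmf (map2 q cs xs))
     = list_product_pmf (map (\<lambda>c. bind_pmf (p c) (q c)) cs)"
proof (induction cs)
  case (Cons c cs)
  have "bind_pmf (list_product_pmf (map p (c # cs))) (\<lambda>xs. list_product_pmf (map2 q (c # cs) xs))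
      = bind_pmf (p c) (\<lambda>x. bind_pmf (list_product_pmf (map p cs)) (\<lambda>xs.
          bind_pmf (q c x) (\<lambda>y. bind_pmf (list_product_pmf (map2 q cs xs)) (\<lambda>ys. return_pmf (y # ys)))))"
    by (simp add: map_pmf_def pair_pmf_def bind_assoc_pmf bind_return_pmf)
  also have "\<dots> = bind_pmf (p c) (\<lambda>x. bind_pmf (q c x) (\<lambda>y. bind_pmf (list_product_pmf (map p cs)) (\<lambda>xs.
          bind_pmf (list_product_pmf (map2 q cs xs)) (\<lambda>ys. return_pmf (y # ys)))))"
    by (subst bind_commute_pmf) simp
  also have "\<dots> = bind_pmf (p c) (\<lambda>x. bind_pmf (q c x) (\<lambda>y.
          bind_pmf (list_product_pmf (map (\<lambda>c. bind_pmf (p c) (q c)) cs)) (\<lambda>ys. return_pmf (y # ys))))"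
    by (simp add: Cons[symmetric] bind_assoc_pmf)
  finally show ?case by (simp add: map_pmf_def pair_pmf_def bind_assoc_pmf bind_return_pmf)
qed (simp add: bind_return_pmf)

lemma list_product_pmf_map:
  "map_pmf (map2 g cs) (list_product_pmf (map p cs)) = list_product_pmf (map (\<lambda>c. map_pmf (g c) (p c)) cs)"
proof (induction cs)
  case (Cons c cs)
  have "map_pmf (map2 g (c # cs)) (list_product_pmf (map p (c # cs)))
      = map_pmf (\<lambda>(x, xs). x # xs) (pair_pmf (map_pmf (g c) (p c)) (map_pmf (map2 g cs) (list_product_pmf (map p cs))))"
    by (simp add: map_pmf_def pair_pmf_def bind_assoc_pmf bind_return_pmf)
  then show ?case by (simp add: Cons)
qed simp

lemma pmf_list_product:
  "pmf (list_product_pmf ps) xs = (if length xs = length ps then (\<Prod>c<length ps. pmf (ps ! c) (xs ! c)) else 0)"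
proof (induction ps arbitrary: xs)
  case (Cons p ps)
  show ?case
  proof (cases xs)
    case Nil
    then show ?thesis by (auto simp: pmf_eq_0_set_pmf)
  next
    case (Cons y ys)
    have "inj (\<lambda>(x, xs). x # xs)" by (auto simp: inj_on_def)
    from pmf_map_inj'[OF this, of "pair_pmf p (list_product_pmf ps)" "(y, ys)"]
    show ?thesis by (simp add: Cons pmf_pair Cons.IH prod.lessThan_Suc_shift del: prod.lessThan_Suc)
  qed
qed (auto simp: pmf_return)

lemma Pi_pmf_image:
  fixes h :: "'a \<Rightarrow> 'b" and p :: "'b \<Rightarrow> 'c pmf"
  assumes "inj h" "finite A"
  shows "map_pmf (\<lambda>\<tau>. \<tau> \<circ> h) (Pi_pmf (h ` A) dflt p) = Pi_pmf A dflt (p \<circ> h)"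
  using assms(2)
proof (induction A rule: finite_induct)
  case empty
  then show ?case by (simp add: o_def)
next
  case (insert x A)
  have hx: "h x \<notin> h ` A" using insert assms(1) by (auto dest: injD)
  have "(f(h x := y)) \<circ> h = (f \<circ> h)(x := y)" for f :: "'b \<Rightarrow> 'c" and y
    using assms(1) by (auto simp: fun_eq_iff dest: injD)
  then have "map_pmf (\<lambda>\<tau>. \<tau> \<circ> h) (Pi_pmf (h ` insert x A) dflt p)
      = map_pmf (\<lambda>(y, f). f(x := y)) (pair_pmf (p (h x)) (map_pmf (\<lambda>\<tau>. \<tau> \<circ> h) (Pi_pmf (h ` A) dflt p)))"
    using insert hx by (simp add: Pi_pmf_insert map_pmf_def pair_pmf_def bind_assoc_pmf bind_return_pmf)
  then show ?case using insert by (simp add: Pi_pmf_insert o_def)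
qed

text \<open>Words beginning with different letters form disjoint blocks, and independent colours on
  disjoint blocks are independent lists of branches.\<close>

lemma Pi_pmf_branches:
  fixes A :: "'a \<Rightarrow> 'a list set"
  assumes "distinct cs" "\<And>c. c \<in> set cs \<Longrightarrow> finite (A c)"
  shows "map_pmf (\<lambda>\<tau>. map (\<lambda>c. \<tau> \<circ> (#) c) cs) (Pi_pmf (\<Union>c\<in>set cs. (#) c ` A c) dflt p)
     = list_product_pmf (map (\<lambda>c. Pi_pmf (A c) dflt (p \<circ> (#) c)) cs)"
  using assms
proof (induction cs)
  case (Cons c cs)
  let ?A = "(#) c ` A c" and ?B = "\<Union>c\<in>set cs. (#) c ` A c"
  have fin: "finite ?A" "finite ?B" and disj: "?A \<inter> ?B = {}" using Cons.prems by auto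
  have "map_pmf (\<lambda>\<tau>. map (\<lambda>c. \<tau> \<circ> (#) c) (c # cs)) (Pi_pmf (?A \<union> ?B) dflt p)
      = map_pmf (\<lambda>(f, g). map (\<lambda>c'. (\<lambda>x. if x \<in> ?A then f x else g x) \<circ> (#) c') (c # cs))
          (pair_pmf (Pi_pmf ?A dflt p) (Pi_pmf ?B dflt p))"
    by (simp add: Pi_pmf_union[OF fin disj] pmf.map_comp o_def case_prod_unfold)
  also have "\<dots> = map_pmf (\<lambda>(f, g). (f \<circ> (#) c) # map (\<lambda>c'. g \<circ> (#) c') cs)
          (pair_pmf (Pi_pmf ?A dflt p) (Pi_pmf ?B dflt p))"
  \<comment> \<open>The default value matters: at words \<open>c # v\<close> outside both blocks the
    merged function reads \<open>g\<close> instead of \<open>f\<close>, and both equal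
    \<open>dflt\<close> there.\<close>
  proof (intro map_pmf_cong refl, clarify)
    fix f g assume "(f, g) \<in> set_pmf (pair_pmf (Pi_pmf ?A dflt p) (Pi_pmf ?B dflt p))"
    then have f: "\<And>x. x \<notin> ?A \<Longrightarrow> f x = dflt" and g: "\<And>x. x \<notin> ?B \<Longrightarrow> g x = dflt"
      using set_Pi_pmf_subset[OF fin(1), of dflt p] set_Pi_pmf_subset[OF fin(2), of dflt p] by auto
    have "(\<lambda>x. if x \<in> ?A then f x else g x) \<circ> (#) c = f \<circ> (#) c"
      using f g Cons.prems by (auto simp: fun_eq_iff)
    moreover have "(\<lambda>x. if x \<in> ?A then f x else g x) \<circ> (#) c' = g \<circ> (#) c'" if "c' \<in> set cs" for c'
      using that Cons.prems by (auto simp: fun_eq_iff)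
    ultimately show "map (\<lambda>c'. (\<lambda>x. if x \<in> ?A then f x else g x) \<circ> (#) c') (c # cs)
        = (f \<circ> (#) c) # map (\<lambda>c'. g \<circ> (#) c') cs" by simp
  qed
  also have "\<dots> = map_pmf (\<lambda>(x, xs). x # xs) (pair_pmf (map_pmf (\<lambda>f. f \<circ> (#) c) (Pi_pmf ?A dflt p))
        (map_pmf (\<lambda>g. map (\<lambda>c'. g \<circ> (#) c') cs) (Pi_pmf ?B dflt p)))"
    by (simp add: map_pmf_def pair_pmf_def bind_assoc_pmf bind_return_pmf)
  also have "\<dots> = list_product_pmf (map (\<lambda>c. Pi_pmf (A c) dflt (p \<circ> (#) c)) (c # cs))"
  proof -
    have "map_pmf (\<lambda>g. map (\<lambda>c'. g \<circ> (#) c') cs) (Pi_pmf ?B dflt p)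
        = list_product_pmf (map (\<lambda>c. Pi_pmf (A c) dflt (p \<circ> (#) c)) cs)"
      using Cons.prems by (intro Cons.IH) auto
    moreover have "map_pmf (\<lambda>f. f \<circ> (#) c) (Pi_pmf ?A dflt p) = Pi_pmf (A c) dflt (p \<circ> (#) c)"
      using Cons.prems by (intro Pi_pmf_image) auto
    ultimately show ?thesis by (simp only: list.map list_product_pmf.simps)
  qed
  finally show ?case by (simp only: list.set UN_insert)
qed simp

lemma verts_Cons: "c # v \<in> verts T \<longleftrightarrow> c < T [] \<and> v \<in> verts (T \<circ> (#) c)"
  by (auto simp: verts_def less_Suc_eq_0_disj nth_Cons' take_Cons' split: if_splits
      dest: spec[of _ 0] spec[of _ "Suc _"])

lemma level_0: "level T 0 = {[]}"
  by (auto simp: level_def verts_def)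

lemma level_Suc: "level T (Suc n) = (\<Union>c\<in>set [0..<T []]. (#) c ` level (T \<circ> (#) c) n)"
  by (auto simp: level_def verts_Cons length_Suc_conv)

lemma finite_level: "finite (level T n)"
  by (induction n arbitrary: T) (simp_all add: level_0 level_Suc)

text \<open>Colours strictly above level \<open>n\<close> are forgotten, while the shape of the tree
  is kept. Since \<open>T\<close> is fixed in \<open>level_law\<close>, keeping the shape adds no
  information there.\<close>

primrec enc :: "nat \<Rightarrow> tree \<Rightarrow> (nat list \<Rightarrow> nat) \<Rightarrow> nat obs" where
  "enc 0 T \<sigma> = Leaf (\<sigma> [])"
| "enc (Suc n) T \<sigma> = Node (map (\<lambda>c. enc n (T \<circ> (#) c) (\<sigma> \<circ> (#) c)) [0..<T []])"

lemma enc_cong: "(\<And>v. v \<in> level T n \<Longrightarrow> \<sigma> v = \<sigma>' v) \<Longrightarrow> enc n T \<sigma> = enc n T \<sigma>'"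
proof (induction n arbitrary: T \<sigma> \<sigma>')
  case (Suc n)
  have "enc n (T \<circ> (#) c) (\<sigma> \<circ> (#) c) = enc n (T \<circ> (#) c) (\<sigma>' \<circ> (#) c)" if "c < T []" for c
  proof (rule Suc.IH)
    fix v assume "v \<in> level (T \<circ> (#) c) n"
    then have "c # v \<in> level T (Suc n)" using that unfolding level_Suc by auto
    then show "(\<sigma> \<circ> (#) c) v = (\<sigma>' \<circ> (#) c) v" by (simp add: Suc.prems)
  qed
  then show ?case by simp
qed (simp add: level_0)

text \<open>
  \<open>colouring\<close> grows the tree at the leaves, while the recursion splits it at the root; the kernel
  that extends an observation by one level mediates between the two.
\<close>

primrec leaf_step :: "nat set \<Rightarrow> nat \<Rightarrow> tree \<Rightarrow> nat obs \<Rightarrow> nat obs pmf" where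
  "leaf_step K 0 T y = (case y of
     Leaf i \<Rightarrow> map_pmf Node (list_product_pmf (map (\<lambda>_. map_pmf Leaf (pmf_of_set (K - {i}))) [0..<T []]))
   | Node ys \<Rightarrow> undefined)"
| "leaf_step K (Suc n) T y = (case y of
     Leaf i \<Rightarrow> undefined
   | Node ys \<Rightarrow> map_pmf Node (list_product_pmf (map2 (\<lambda>c. leaf_step K n (T \<circ> (#) c)) [0..<T []] ys)))"

lemma map_enc_Pi_pmf:
  "map_pmf (enc (Suc n) T) (Pi_pmf (level T (Suc n)) undefined p)
     = map_pmf Node (list_product_pmf (map (\<lambda>c. map_pmf (enc n (T \<circ> (#) c))
         (Pi_pmf (level (T \<circ> (#) c) n) undefined (p \<circ> (#) c))) [0..<T []]))"
proof -
  have eq: "enc (Suc n) T = Node \<circ> (map2 (\<lambda>c. enc n (T \<circ> (#) c)) [0..<T []] \<circ> (\<lambda>\<tau>. map (\<lambda>c. \<tau> \<circ> (#) c) [0..<T []]))"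
    by (simp add: fun_eq_iff zip_map2 zip_same_conv_map)
  show ?thesis
    unfolding eq pmf.map_comp[symmetric] level_Suc
    by (simp only: Pi_pmf_branches[OF distinct_upt finite_level] list_product_pmf_map)
qed

text \<open>The Markov property: the colours of a new level depend on the earlier ones only through
  the current level, so extending a configuration descends to a kernel on observations.\<close>

lemma leaf_step_enc:
  "map_pmf (enc (Suc n) T) (Pi_pmf (level T (Suc n)) undefined (\<lambda>v. pmf_of_set (K - {\<sigma> (butlast v)})))
     = leaf_step K n T (enc n T \<sigma>)"
proof (induction n arbitrary: T \<sigma>)
  case 0
  have "map_pmf (enc 0 T') (Pi_pmf (level T' 0) undefined p) = map_pmf Leaf (p [])" for T' and p :: "nat list \<Rightarrow> nat pmf"
  proof -
    have "enc 0 T' = Leaf \<circ> (\<lambda>\<tau>. \<tau> [])" by (simp add: fun_eq_iff)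
    then have "map_pmf (enc 0 T') (Pi_pmf (level T' 0) undefined p) = map_pmf Leaf (map_pmf (\<lambda>\<tau>. \<tau> []) (Pi_pmf {[]} undefined p))"
      by (simp add: pmf.map_comp level_0)
    then show ?thesis by (simp add: Pi_pmf_component)
  qed
  then show ?case unfolding map_enc_Pi_pmf by simp
next
  case (Suc n)
  \<comment> \<open>Words at level \<open>Suc n\<close> are nonempty, so \<open>butlast\<close>
    commutes with prefixing \<open>c\<close>, and the parent stays in the same branch.\<close>
  have "map_pmf (enc (Suc n) (T \<circ> (#) c)) (Pi_pmf (level (T \<circ> (#) c) (Suc n)) undefined
         ((\<lambda>v. pmf_of_set (K - {\<sigma> (butlast v)})) \<circ> (#) c))
      = leaf_step K n (T \<circ> (#) c) (enc n (T \<circ> (#) c) (\<sigma> \<circ> (#) c))" for c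
    unfolding Suc[symmetric] by (intro arg_cong2[of _ _ _ _ map_pmf] Pi_pmf_cong refl) (auto simp: level_def)
  then show ?case unfolding map_enc_Pi_pmf[of "Suc n"] by (simp add: zip_map2 zip_same_conv_map o_def)
qed

section \<open>Conditioning on the root colour\<close>

primrec rooted_colouring :: "nat \<Rightarrow> tree \<Rightarrow> nat \<Rightarrow> nat \<Rightarrow> (nat list \<Rightarrow> nat) pmf" where
  "rooted_colouring k T 0 i = return_pmf ((\<lambda>_. undefined)([] := i))"
| "rooted_colouring k T (Suc n) i =
     bind_pmf (rooted_colouring k T n i) (\<lambda>\<sigma>.
       map_pmf (\<lambda>\<tau>. override_on \<sigma> \<tau> (level T (Suc n)))
         (Pi_pmf (level T (Suc n)) undefined (\<lambda>v. pmf_of_set ({1..k} - {\<sigma> (butlast v)}))))"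

lemma colouring_conv_rooted: "colouring k T n = bind_pmf (pmf_of_set {1..k}) (rooted_colouring k T n)"
  by (induction n) (simp_all add: map_pmf_def bind_assoc_pmf)

lemma map_root_rooted: "map_pmf (\<lambda>\<sigma>. \<sigma> []) (rooted_colouring k T n i) = return_pmf i"
proof (induction n)
  case (Suc n)
  have "override_on \<sigma> \<tau> (level T (Suc n)) [] = \<sigma> []" for \<sigma> \<tau> :: "nat list \<Rightarrow> nat"
    by (simp add: level_def)
  then have "map_pmf (\<lambda>\<sigma>. \<sigma> []) (rooted_colouring k T (Suc n) i) = map_pmf (\<lambda>\<sigma>. \<sigma> []) (rooted_colouring k T n i)"
    by (simp add: map_bind_pmf pmf.map_comp o_def) (simp add: map_pmf_def)
  then show ?case using Suc by simp
qed simp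

lemma root_rooted: "\<sigma> \<in> set_pmf (rooted_colouring k T n i) \<Longrightarrow> \<sigma> [] = i"
  using arg_cong[OF map_root_rooted, of set_pmf k T n i] by auto

text \<open>The colouring is a uniform mixture of the rooted ones, and these have disjoint supports
  because the root colour never changes; conditioning picks out one component, of weight
  \<open>1 / k\<close>.\<close>

lemma cond_colouring:
  assumes i: "i \<in> {1..k}"
  shows "cond_pmf (colouring k T n) {\<sigma>. \<sigma> [] = i} = rooted_colouring k T n i"
proof -
  have ne: "{1..k} \<noteq> {}" using i by auto
  have "map_pmf (\<lambda>\<sigma>. \<sigma> []) (colouring k T n) = pmf_of_set {1..k}"
    by (simp add: colouring_conv_rooted map_bind_pmf map_root_rooted bind_return_pmf')
  moreover have "measure_pmf.prob (map_pmf (\<lambda>\<sigma>. \<sigma> []) (colouring k T n)) {i}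
      = measure_pmf.prob (colouring k T n) {\<sigma>. \<sigma> [] = i}"
    by (simp add: vimage_def)
  ultimately have "measure_pmf.prob (colouring k T n) {\<sigma>. \<sigma> [] = i} = pmf (pmf_of_set {1..k}) i"
    by (simp only: measure_pmf_single)
  then have m: "measure_pmf.prob (colouring k T n) {\<sigma>. \<sigma> [] = i} = 1 / real k" using i ne by simp
  have "set_pmf (colouring k T n) \<inter> {\<sigma>. \<sigma> [] = i} \<noteq> {}"
  proof
    assume "set_pmf (colouring k T n) \<inter> {\<sigma>. \<sigma> [] = i} = {}"
    then have "measure_pmf.prob (colouring k T n) {\<sigma>. \<sigma> [] = i} = 0" by (simp add: measure_pmf_zero_iff Int_commute)
    then show False using m i by simp
  qed
  note pc = pmf_cond[OF this]
  show ?thesis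
  proof (rule pmf_eqI)
    fix \<sigma>
    have 0: "pmf (rooted_colouring k T n j) \<sigma> = 0" if "\<sigma> [] \<noteq> j" for j
      using root_rooted[of \<sigma> k T n j] that by (auto simp: pmf_eq_0_set_pmf)
    have "pmf (colouring k T n) \<sigma> = (\<Sum>j\<in>{1..k}. pmf (rooted_colouring k T n j) \<sigma>) / real k"
      using ne by (simp add: colouring_conv_rooted pmf_bind_pmf_of_set)
    moreover have "(\<Sum>j\<in>{1..k}. pmf (rooted_colouring k T n j) \<sigma>) = pmf (rooted_colouring k T n i) \<sigma>" if "\<sigma> [] = i"
      using i 0 that by (subst sum.remove[of _ i]) (auto intro!: sum.neutral)
    ultimately show "pmf (cond_pmf (colouring k T n) {\<sigma>. \<sigma> [] = i}) \<sigma> = pmf (rooted_colouring k T n i) \<sigma>"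
      using i 0[of i] by (simp add: pc m)
  qed
qed

definition tree_obs :: "nat \<Rightarrow> nat \<Rightarrow> tree \<Rightarrow> nat \<Rightarrow> nat obs pmf" where
  "tree_obs k n T i = map_pmf (enc n T) (rooted_colouring k T n i)"

lemma tree_obs_step: "tree_obs k (Suc n) T i = bind_pmf (tree_obs k n T i) (leaf_step {1..k} n T)"
proof -
  have *: "enc (Suc n) T (override_on \<sigma> \<tau> (level T (Suc n))) = enc (Suc n) T \<tau>" for \<sigma> \<tau>
    by (rule enc_cong) simp
  show ?thesis
    unfolding tree_obs_def rooted_colouring.simps map_bind_pmf pmf.map_comp o_def * leaf_step_enc bind_map_pmf ..
qed

text \<open>By induction, growth at the leaves commutes with the split at the root:
  \<open>leaf_step\<close> acts branch by branch on the product, and in each branch it produces the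
  observation one level deeper.\<close>

lemma tree_obs_Suc:
  "tree_obs k (Suc n) T i = map_pmf Node (list_product_pmf
     (map (\<lambda>c. bind_pmf (pmf_of_set ({1..k} - {i})) (tree_obs k n (T \<circ> (#) c))) [0..<T []]))"
proof (induction n arbitrary: T i)
  case 0
  show ?case unfolding tree_obs_step[of k 0] by (simp add: tree_obs_def bind_return_pmf map_pmf_def)
next
  case (Suc n)
  have "tree_obs k (Suc (Suc n)) T i = bind_pmf (list_product_pmf
     (map (\<lambda>c. bind_pmf (pmf_of_set ({1..k} - {i})) (tree_obs k n (T \<circ> (#) c))) [0..<T []]))
     (\<lambda>ys. map_pmf Node (list_product_pmf (map2 (\<lambda>c. leaf_step {1..k} n (T \<circ> (#) c)) [0..<T []] ys)))"
    unfolding tree_obs_step[of k "Suc n"] Suc bind_map_pmf by simp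
  also have "\<dots> = map_pmf Node (list_product_pmf (map (\<lambda>c. bind_pmf (bind_pmf (pmf_of_set ({1..k} - {i})) (tree_obs k n (T \<circ> (#) c)))
       (leaf_step {1..k} n (T \<circ> (#) c))) [0..<T []]))"
    unfolding list_product_pmf_bind[symmetric] map_bind_pmf ..
  finally show ?case by (simp only: bind_assoc_pmf tree_obs_step[symmetric])
qed

section \<open>Total variation of the level laws\<close>

lemma abs_prob_diff_le_1: "\<bar>measure_pmf.prob p A - measure_pmf.prob q A\<bar> \<le> 1"
  using measure_pmf.prob_le_1[of p A] measure_pmf.prob_le_1[of q A]
    measure_nonneg[of p A] measure_nonneg[of q A] by linarith

lemma prob_diff_le_tv_dist: "measure_pmf.prob p A - measure_pmf.prob q A \<le> tv_dist p q"
proof -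
  have "bdd_above (range (\<lambda>A. \<bar>measure_pmf.prob p A - measure_pmf.prob q A\<bar>))"
    by (rule bdd_aboveI2) (rule abs_prob_diff_le_1)
  then have "\<bar>measure_pmf.prob p A - measure_pmf.prob q A\<bar> \<le> tv_dist p q"
    unfolding tv_dist_def by (rule cSUP_upper[OF UNIV_I])
  then show ?thesis by simp
qed

lemma tv_dist_le_1: "tv_dist p q \<le> 1"
  unfolding tv_dist_def by (rule cSUP_least) (simp_all add: abs_prob_diff_le_1)

lemma tv_dist_nonneg: "0 \<le> tv_dist p q"
  using prob_diff_le_tv_dist[of p "{}" q] by simp

text \<open>For a fixed tree the observation is a function of the level colours, so every event
  about it pulls back to an event tested by the total variation distance.\<close>

lemma tree_obs_diff_le_tv_dist:
  assumes "i \<in> {1..k}" "j \<in> {1..k}"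
  shows "measure_pmf.prob (tree_obs k n T i) A - measure_pmf.prob (tree_obs k n T j) A
      \<le> tv_dist (level_law k T n i) (level_law k T n j)"
proof -
  have *: "tree_obs k n T l = map_pmf (enc n T) (level_law k T n l)" if "l \<in> {1..k}" for l
    unfolding level_law_def cond_colouring[OF that] tree_obs_def pmf.map_comp
    by (intro map_pmf_cong refl) (auto intro!: enc_cong)
  show ?thesis
    using prob_diff_le_tv_dist[of "level_law k T n i" "enc n T -` A" "level_law k T n j"]
    by (simp add: *[OF assms(1)] *[OF assms(2)])
qed

section \<open>Random trees\<close>

instance obs :: (countable) countable by countable_datatype

abbreviation tree_space :: "tree measure" where
  "tree_space \<equiv> \<Pi>\<^sub>M v\<in>UNIV. count_space UNIV"

text \<open>Encoding with a constant colour records just the first \<open>n\<close> levels, with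
  values in a countable type; measurability in \<open>T\<close> is derived from this.\<close>

definition shape :: "nat \<Rightarrow> tree \<Rightarrow> nat obs" where "shape n T = enc n T (\<lambda>_. 0)"

lemma shape_simps: "shape 0 T = Leaf 0" "shape (Suc n) T = Node (map (\<lambda>c. shape n (T \<circ> (#) c)) [0..<T []])"
  by (simp_all add: shape_def o_def)

lemma measurable_subtree: "(\<lambda>T. T \<circ> (#) c) \<in> measurable tree_space tree_space"
  unfolding o_def by (rule measurable_PiM_single') (auto intro: measurable_component_singleton simp: space_PiM)

lemma sets_shape: "{T. shape n T = y} \<in> sets tree_space"
proof (induction n arbitrary: y)
  case 0
  have "{T. shape 0 T = y} = {} \<or> {T. shape 0 T = y} = space tree_space"
    by (auto simp: shape_simps space_PiM)
  then show ?case by (metis sets.empty_sets sets.top)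
next
  case (Suc n)
  show ?case
  proof (cases y)
    case (Node ys)
    have "{T. shape (Suc n) T = y} = {T \<in> space tree_space. T [] = length ys} \<inter>
        {T \<in> space tree_space. \<forall>c\<in>{..<length ys}. shape n (T \<circ> (#) c) = ys ! c}"
      by (auto simp: shape_simps Node list_eq_iff_nth_eq space_PiM)
    also have "\<dots> \<in> sets tree_space"
    proof (intro sets.Int sets.sets_Collect_finite_All)
      have "(\<lambda>T. T []) \<in> measurable tree_space (count_space UNIV)" by (intro measurable_component_singleton) simp
      from measurable_sets[OF this, of "{length ys}"]
      show "{T \<in> space tree_space. T [] = length ys} \<in> sets tree_space"
        by (simp add: vimage_def Collect_conj_eq Int_commute)
    next
      fix c
      from measurable_sets[OF measurable_subtree Suc, of c "ys ! c"]
      show "{T \<in> space tree_space. shape n (T \<circ> (#) c) = ys ! c} \<in> sets tree_space"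
        by (simp add: vimage_def Collect_conj_eq Int_commute)
    qed auto
    finally show ?thesis .
  qed (simp add: shape_simps)
qed

lemma measurable_shape: "shape n \<in> measurable tree_space (count_space UNIV)"
  by (subst measurable_count_space_eq_countable)
     (auto simp: space_PiM vimage_def sets_shape)

text \<open>\<open>f\<close> factors through a measurable map into a countable discrete space, on
  which every function is measurable. The factor evaluates \<open>f\<close> at a chosen tree of the
  given shape.\<close>

lemma measurable_of_shape:
  fixes f :: "tree \<Rightarrow> real"
  assumes "\<And>T T'. shape n T = shape n T' \<Longrightarrow> f T = f T'"
  shows "f \<in> borel_measurable tree_space"
proof -
  have "f T = f (SOME T'. shape n T' = shape n T)" for T
    by (rule assms) (rule sym, rule someI[of _ T], rule refl)
  then have "f = (\<lambda>y. f (SOME T'. shape n T' = y)) \<circ> shape n" by (simp add: fun_eq_iff)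
  moreover have "(\<lambda>y. f (SOME T'. shape n T' = y)) \<circ> shape n \<in> borel_measurable tree_space"
    by (rule measurable_comp[OF measurable_shape]) simp
  ultimately show ?thesis by simp
qed

lemma shape_Suc_eqD:
  assumes "shape (Suc n) T = shape (Suc n) T'"
  shows "T [] = T' []" "c < T [] \<Longrightarrow> shape n (T \<circ> (#) c) = shape n (T' \<circ> (#) c)"
  using assms by (auto simp: shape_simps list_eq_iff_nth_eq)

lemma level_cong: "shape n T = shape n T' \<Longrightarrow> m \<le> n \<Longrightarrow> level T m = level T' m"
proof (induction n arbitrary: T T' m)
  case (Suc n)
  show ?case
  proof (cases m)
    case (Suc m')
    then have "level (T \<circ> (#) c) m' = level (T' \<circ> (#) c) m'" if "c < T []" for c
      using that Suc.prems by (intro Suc.IH shape_Suc_eqD(2)) auto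
    then show ?thesis using shape_Suc_eqD(1)[OF Suc.prems(1)] unfolding Suc level_Suc by auto
  qed (simp add: level_0)
qed (simp add: level_0)

lemma colouring_cong: "shape n T = shape n T' \<Longrightarrow> m \<le> n \<Longrightarrow> colouring k T m = colouring k T' m"
proof (induction m)
  case (Suc m)
  then show ?case using level_cong[OF Suc.prems] by simp
qed simp

lemma level_law_cong: "shape n T = shape n T' \<Longrightarrow> level_law k T n i = level_law k T' n i"
  unfolding level_law_def using colouring_cong[of n T T' n] level_cong[of n T T' n] by simp

lemma tree_obs_cong: "shape n T = shape n T' \<Longrightarrow> tree_obs k n T i = tree_obs k n T' i"
proof (induction n arbitrary: T T' i)
  case (Suc n)
  have "tree_obs k n (T \<circ> (#) c) = tree_obs k n (T' \<circ> (#) c)" if "c < T []" for c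
    using that Suc.prems by (intro ext Suc.IH shape_Suc_eqD(2)) auto
  then show ?case unfolding tree_obs_Suc using shape_Suc_eqD(1)[OF Suc.prems]
    by (intro arg_cong[of _ _ "map_pmf Node"] arg_cong[of _ _ list_product_pmf]) auto
qed (simp add: tree_obs_def)

lemma borel_measurable_tree_obs: "(\<lambda>T. f (tree_obs k n T i)) \<in> borel_measurable tree_space"
  for f :: "nat obs pmf \<Rightarrow> real"
proof (rule measurable_of_shape)
  fix T T' assume "shape n T = shape n T'"
  then have "tree_obs k n T i = tree_obs k n T' i" by (rule tree_obs_cong)
  then show "f (tree_obs k n T i) = f (tree_obs k n T' i)" by simp
qed

lemma borel_measurable_tv_dist_level_law:
  "(\<lambda>T. tv_dist (level_law k T n i) (level_law k T n j)) \<in> borel_measurable tree_space"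
proof (rule measurable_of_shape)
  fix T T' assume "shape n T = shape n T'"
  then have "level_law k T n l = level_law k T' n l" for l by (rule level_law_cong)
  then show "tv_dist (level_law k T n i) (level_law k T n j) = tv_dist (level_law k T' n i) (level_law k T' n j)"
    by simp
qed

lemma pmf_tree_obs_Node:
  "pmf (tree_obs k (Suc n) T i) (Node ys) = (if T [] = length ys then
     (\<Prod>c<length ys. pmf (bind_pmf (pmf_of_set ({1..k} - {i})) (tree_obs k n (T \<circ> (#) c))) (ys ! c)) else 0)"
  unfolding tree_obs_Suc pmf_map_inj'[OF inj_Node] pmf_list_product by (auto intro!: prod.cong)

lemma pmf_tree_obs_Leaf: "pmf (tree_obs k (Suc n) T i) (Leaf c) = 0"
  unfolding tree_obs_Suc by (auto simp: pmf_eq_0_set_pmf)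

lemma list_product_pmf_const: "list_product_pmf (map (\<lambda>_. p) cs) = replicate_pmf (length cs) p"
  by (induction cs) (simp_all add: map_pmf_def pair_pmf_def bind_assoc_pmf bind_return_pmf)

lemma tree_obs_regular: "tree_obs k n (\<lambda>_. d) i = obs_pmf {1..k} (return_pmf d) n i"
proof (induction n arbitrary: i)
  case (Suc n)
  have "tree_obs k n (\<lambda>_. d) = obs_pmf {1..k} (return_pmf d) n" using Suc by (intro ext)
  then show ?case
    unfolding tree_obs_Suc by (simp add: o_def list_product_pmf_const bind_return_pmf)
qed (simp add: tree_obs_def)

text \<open>The interface between random trees and the recursion: averaging the law of the
  observation for a fixed tree over \<open>M\<close> returns the joint law
  \<open>obs_pmf\<close>.\<close>

definition law_matches :: "nat \<Rightarrow> nat pmf \<Rightarrow> tree measure \<Rightarrow> bool" where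
  "law_matches k \<xi> M \<longleftrightarrow> prob_space M \<and> sets M = sets tree_space \<and>
     (\<forall>n. \<forall>i\<in>{1..k}. \<forall>y. (\<integral>T. pmf (tree_obs k n T i) y \<partial>M) = pmf (obs_pmf {1..k} \<xi> n i) y)"

lemma law_matches_regular: "law_matches k (return_pmf d) (regular_tree d)"
  unfolding law_matches_def regular_tree_def
proof (intro conjI allI ballI)
  fix n i y
  show "(\<integral>T. pmf (tree_obs k n T i) y \<partial>return tree_space (\<lambda>_. d)) = pmf (obs_pmf {1..k} (return_pmf d) n i) y"
    by (subst integral_return[OF _ borel_measurable_tree_obs]) (simp_all add: space_PiM tree_obs_regular)
qed (auto intro!: prob_space_return simp: space_PiM)

section \<open>Branching structure of the Galton-Watson measure\<close>

lemma sets_gw_tree: "sets (gw_tree \<xi>) = sets tree_space"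
  unfolding gw_tree_def by (intro sets_PiM_cong) auto

lemma prob_space_gw_tree: "prob_space (gw_tree \<xi>)"
  unfolding gw_tree_def by (intro prob_space_PiM measure_pmf.prob_space_axioms)

lemma measurable_gw_tree: "f \<in> measurable tree_space N \<Longrightarrow> f \<in> measurable (gw_tree \<xi>) N"
  using measurable_cong_sets[OF sets_gw_tree refl] by blast

lemma restrict_UNIV: "restrict f UNIV = f"
  by (simp add: fun_eq_iff)

lemma distr_gw_subtree: "distr (gw_tree \<xi>) (gw_tree \<xi>) (\<lambda>T. T \<circ> (#) c) = gw_tree \<xi>"
  using distr_PiM_reindex[of UNIV "\<lambda>_. measure_pmf \<xi>" "(#) c" UNIV]
  by (simp add: gw_tree_def measure_pmf.prob_space_axioms o_def inj_on_def restrict_UNIV)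

lemma distr_gw_root: "distr (gw_tree \<xi>) (measure_pmf \<xi>) (\<lambda>T. T []) = measure_pmf \<xi>"
  unfolding gw_tree_def by (rule distr_PiM_component) (simp_all add: measure_pmf.prob_space_axioms)

lemma indep_vars_gw:
  "prob_space.indep_vars (gw_tree \<xi>) (\<lambda>_. measure_pmf \<xi>) (\<lambda>v T. T v) UNIV"
proof -
  interpret prob_space "gw_tree \<xi>" by (rule prob_space_gw_tree)
  have rv: "random_variable (measure_pmf \<xi>) (\<lambda>T. T v)" for v
    unfolding gw_tree_def by (intro measurable_component_singleton) simp
  have "distr (gw_tree \<xi>) (measure_pmf \<xi>) (\<lambda>T. T v) = measure_pmf \<xi>" for v
    unfolding gw_tree_def by (rule distr_PiM_component) (simp_all add: measure_pmf.prob_space_axioms)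
  moreover have "distr (gw_tree \<xi>) (gw_tree \<xi>) (\<lambda>T. T) = gw_tree \<xi>" by (rule distr_id)
  ultimately show ?thesis
    by (subst indep_vars_iff_distr_eq_PiM') (simp, rule rv, simp add: restrict_UNIV gw_tree_def[symmetric])
qed

text \<open>Words off the tree carry offspring numbers too, so the subtree at \<open>c\<close> is
  defined whatever the root offspring number is. It is independent of that number and of the other
  subtrees, being a function of a disjoint block of coordinates.\<close>

lemma integral_gw_branches:
  fixes g :: "nat \<Rightarrow> tree \<Rightarrow> real"
  assumes g: "\<And>c. g c \<in> borel_measurable tree_space" and bounded: "\<And>c T. \<bar>g c T\<bar> \<le> 1"
  shows "(\<integral>T. (if T [] = D then \<Prod>c<D. g c (T \<circ> (#) c) else 0) \<partial>gw_tree \<xi>)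
           = pmf \<xi> D * (\<Prod>c<D. \<integral>T. g c T \<partial>gw_tree \<xi>)"
proof -
  interpret prob_space "gw_tree \<xi>" by (rule prob_space_gw_tree)
  \<comment> \<open>Index 0 is the root coordinate and index \<open>Suc c\<close> the block below
    child \<open>c\<close>; hence \<open>Suc D\<close> independent factors.\<close>
  define B :: "nat \<Rightarrow> nat list set" where "B b = (case b of 0 \<Rightarrow> {[]} | Suc c \<Rightarrow> range ((#) c))" for b
  define Y :: "nat \<Rightarrow> (nat list \<Rightarrow> nat) \<Rightarrow> real" where
    "Y b r = (case b of 0 \<Rightarrow> (if r [] = D then 1 else 0) | Suc c \<Rightarrow> g c (r \<circ> (#) c))" for b r
  have "indep_vars (\<lambda>b. \<Pi>\<^sub>M v\<in>B b. measure_pmf \<xi>) (\<lambda>b T. restrict (\<lambda>v. T v) (B b)) {..<Suc D}"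
    by (rule indep_vars_restrict[OF indep_vars_gw])
       (auto simp: disjoint_family_on_def B_def split: nat.splits)
  then have "indep_vars (\<lambda>_. borel) (\<lambda>b T. Y b (restrict (\<lambda>v. T v) (B b))) {..<Suc D}"
  proof (rule indep_vars_compose2)
    fix b
    show "Y b \<in> measurable (\<Pi>\<^sub>M v\<in>B b. measure_pmf \<xi>) borel"
    proof (cases b)
      case 0
      have "(\<lambda>r. r []) \<in> measurable (\<Pi>\<^sub>M v\<in>B b. measure_pmf \<xi>) (measure_pmf \<xi>)"
        by (intro measurable_component_singleton) (simp add: B_def 0)
      then have "(\<lambda>n. if n = D then 1 else 0 :: real) \<circ> (\<lambda>r. r []) \<in> measurable (\<Pi>\<^sub>M v\<in>B b. measure_pmf \<xi>) borel"
        by (rule measurable_comp) simp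
      then show ?thesis by (simp add: Y_def[abs_def] 0 o_def)
    next
      case (Suc c)
      have "(\<lambda>r v. r (c # v)) \<in> measurable (\<Pi>\<^sub>M v\<in>B b. measure_pmf \<xi>) (gw_tree \<xi>)"
        unfolding gw_tree_def
        by (intro measurable_PiM_single' measurable_component_singleton) (auto simp: B_def Suc space_PiM)
      then have "g c \<circ> (\<lambda>r v. r (c # v)) \<in> measurable (\<Pi>\<^sub>M v\<in>B b. measure_pmf \<xi>) borel"
        by (rule measurable_comp) (intro measurable_gw_tree g)
      then show ?thesis by (simp add: Y_def[abs_def] Suc o_def)
    qed
  qed
  moreover have "(\<lambda>T. Y b (restrict (\<lambda>v. T v) (B b))) =
      (case b of 0 \<Rightarrow> (\<lambda>T. if T [] = D then 1 else 0) | Suc c \<Rightarrow> (\<lambda>T. g c (T \<circ> (#) c)))" for b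
  proof -
    have "restrict (\<lambda>v. T v) (range ((#) c)) \<circ> (#) c = T \<circ> (#) c" for T :: tree and c
      by (auto simp: fun_eq_iff)
    then show ?thesis by (intro ext) (cases b, simp_all only: Y_def B_def nat.case, simp)
  qed
  ultimately have ind: "indep_vars (\<lambda>_. borel) (\<lambda>b. case b of 0 \<Rightarrow> (\<lambda>T. if T [] = D then 1 else 0 :: real) | Suc c \<Rightarrow> (\<lambda>T. g c (T \<circ> (#) c))) {..<Suc D}"
    by simp
  have meas: "(\<lambda>T. g c (T \<circ> (#) c)) \<in> borel_measurable (gw_tree \<xi>)" for c
    by (rule measurable_gw_tree) (rule measurable_compose[OF measurable_subtree g])
  have root: "(\<lambda>T. T []) \<in> measurable (gw_tree \<xi>) (measure_pmf \<xi>)"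
    unfolding gw_tree_def by (intro measurable_component_singleton) simp
  have int: "integrable (gw_tree \<xi>) (case b of 0 \<Rightarrow> (\<lambda>T. if T [] = D then 1 else 0 :: real) | Suc c \<Rightarrow> (\<lambda>T. g c (T \<circ> (#) c)))" for b
  proof (cases b)
    case 0
    have "(\<lambda>n. if n = D then 1 else 0 :: real) \<circ> (\<lambda>T. T []) \<in> borel_measurable (gw_tree \<xi>)"
      by (rule measurable_comp[OF root]) simp
    then show ?thesis unfolding 0 by (intro integrable_const_bound[of _ 1]) (auto simp: o_def)
  next
    case (Suc c)
    show ?thesis unfolding Suc using bounded meas by (intro integrable_const_bound[of _ 1]) auto
  qed
  have "(\<integral>T. (if T [] = D then \<Prod>c<D. g c (T \<circ> (#) c) else 0) \<partial>gw_tree \<xi>)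
      = (\<integral>T. (\<Prod>b<Suc D. (case b of 0 \<Rightarrow> (\<lambda>T. if T [] = D then 1 else 0 :: real) | Suc c \<Rightarrow> (\<lambda>T. g c (T \<circ> (#) c))) T) \<partial>gw_tree \<xi>)"
    by (intro Bochner_Integration.integral_cong refl) (simp add: prod.lessThan_Suc_shift del: prod.lessThan_Suc)
  also have "\<dots> = (\<Prod>b<Suc D. \<integral>T. (case b of 0 \<Rightarrow> (\<lambda>T. if T [] = D then 1 else 0 :: real) | Suc c \<Rightarrow> (\<lambda>T. g c (T \<circ> (#) c))) T \<partial>gw_tree \<xi>)"
    by (rule indep_vars_lebesgue_integral[OF _ ind int]) simp
  also have "\<dots> = (\<integral>T. (if T [] = D then 1 else 0) \<partial>gw_tree \<xi>) * (\<Prod>c<D. \<integral>T. g c (T \<circ> (#) c) \<partial>gw_tree \<xi>)"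
    by (simp add: prod.lessThan_Suc_shift del: prod.lessThan_Suc)
  also have "(\<integral>T. (if T [] = D then 1 else 0) \<partial>gw_tree \<xi>) = pmf \<xi> D"
  proof -
    have "(\<integral>T. (if T [] = D then 1 else 0 :: real) \<partial>gw_tree \<xi>) = (\<integral>n. indicator {D} n \<partial>distr (gw_tree \<xi>) (measure_pmf \<xi>) (\<lambda>T. T []))"
      by (subst integral_distr[OF root]) (auto simp: indicator_def intro!: Bochner_Integration.integral_cong)
    then show ?thesis by (simp add: distr_gw_root measure_pmf_single)
  qed
  finally have *: "(\<integral>T. (if T [] = D then \<Prod>c<D. g c (T \<circ> (#) c) else 0) \<partial>gw_tree \<xi>)
      = pmf \<xi> D * (\<Prod>c<D. \<integral>T. g c (T \<circ> (#) c) \<partial>gw_tree \<xi>)" .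
  have "(\<integral>T. g c (T \<circ> (#) c) \<partial>gw_tree \<xi>) = (\<integral>T. g c T \<partial>gw_tree \<xi>)" for c
  proof -
    have "(\<lambda>T. T \<circ> (#) c) \<in> measurable (gw_tree \<xi>) (gw_tree \<xi>)"
      using measurable_gw_tree[OF measurable_subtree] measurable_cong_sets[OF refl sets_gw_tree] by blast
    from integral_distr[OF this measurable_gw_tree[OF g], of c] show ?thesis by (simp add: distr_gw_subtree)
  qed
  then show ?thesis by (simp only: *)
qed

lemma law_matches_gw:
  assumes k: "2 \<le> k" shows "law_matches k \<xi> (gw_tree \<xi>)"
proof -
  interpret prob_space "gw_tree \<xi>" by (rule prob_space_gw_tree)
  have int: "integrable (gw_tree \<xi>) (\<lambda>T. pmf (tree_obs k n T i) y)" for n i y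
    by (rule integrable_const_bound[of _ 1]) (auto simp: pmf_le_1 intro: measurable_gw_tree borel_measurable_tree_obs)
  have "(\<integral>T. pmf (tree_obs k n T i) y \<partial>gw_tree \<xi>) = pmf (obs_pmf {1..k} \<xi> n i) y" if "i \<in> {1..k}" for n i y
    using that
  proof (induction n arbitrary: i y)
    case 0
    then show ?case by (simp add: tree_obs_def prob_space)
  next
    case (Suc n)
    let ?K = "{1..k} - {i}"
    have K: "?K \<noteq> {}"
    proof
      assume "?K = {}"
      then have "card {1..k} \<le> card {i}" by (intro card_mono) auto
      then show False using k by simp
    qed
    show ?case
    proof (cases y)
      case (Leaf c)
      then show ?thesis by (simp only: pmf_tree_obs_Leaf pmf_obs_Leaf) simp
    next
      case (Node ys)
      let ?g = "\<lambda>c T. pmf (bind_pmf (pmf_of_set ?K) (tree_obs k n T)) (ys ! c)"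
      have g: "?g c T = (\<Sum>j\<in>?K. pmf (tree_obs k n T j) (ys ! c)) / real (card ?K)" for c T
        using K by (simp add: pmf_bind_pmf_of_set)
      have "(\<integral>T. ?g c T \<partial>gw_tree \<xi>) = pmf (bind_pmf (pmf_of_set ?K) (obs_pmf {1..k} \<xi> n)) (ys ! c)" for c
        unfolding g using K by (simp add: int Suc.IH pmf_bind_pmf_of_set)
      moreover have "(\<integral>T. pmf (tree_obs k (Suc n) T i) y \<partial>gw_tree \<xi>) = pmf \<xi> (length ys) * (\<Prod>c<length ys. \<integral>T. ?g c T \<partial>gw_tree \<xi>)"
        unfolding Node pmf_tree_obs_Node
      proof (rule integral_gw_branches)
        show "?g c \<in> borel_measurable tree_space" for c
          unfolding g by (intro borel_measurable_divide borel_measurable_sum borel_measurable_tree_obs borel_measurable_const)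
      qed (simp add: pmf_le_1)
      ultimately show ?thesis
        unfolding Node pmf_obs_Node by (simp add: prod.list_conv_set_nth atLeast0LessThan)
    qed
  qed
  then show ?thesis unfolding law_matches_def using prob_space_gw_tree sets_gw_tree by blast
qed

text \<open>The passage from single observations to events is an interchange of sum and expectation,
  valid by nonnegativity.\<close>

lemma law_matches_prob:
  assumes M: "law_matches k \<xi> M" and i: "i \<in> {1..k}"
  shows "(\<lambda>T. measure_pmf.prob (tree_obs k n T i) A) \<in> borel_measurable M"
    and "(\<integral>T. measure_pmf.prob (tree_obs k n T i) A \<partial>M) = measure_pmf.prob (obs_pmf {1..k} \<xi> n i) A"
proof -
  interpret prob_space M using M by (simp add: law_matches_def)
  have cong: "f \<in> borel_measurable tree_space \<Longrightarrow> f \<in> borel_measurable M" for f :: "tree \<Rightarrow> real"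
    using M measurable_cong_sets[of M tree_space] by (auto simp: law_matches_def)
  show meas: "(\<lambda>T. measure_pmf.prob (tree_obs k n T i) A) \<in> borel_measurable M"
    by (rule cong) (rule borel_measurable_tree_obs)
  have mp: "(\<lambda>T. pmf (tree_obs k n T i) y) \<in> borel_measurable M" for y
    by (intro cong borel_measurable_tree_obs)
  have "(\<integral>\<^sup>+T. ennreal (measure_pmf.prob (tree_obs k n T i) A) \<partial>M)
      = (\<integral>\<^sup>+T. \<integral>\<^sup>+y. ennreal (pmf (tree_obs k n T i) y) \<partial>count_space A \<partial>M)"
    by (simp add: nn_integral_pmf measure_pmf.emeasure_eq_measure)
  also have "\<dots> = (\<integral>\<^sup>+y. \<integral>\<^sup>+T. ennreal (pmf (tree_obs k n T i) y) \<partial>M \<partial>count_space A)"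
    using mp by (intro nn_integral_count_space_nn_integral) auto
  also have "\<dots> = (\<integral>\<^sup>+y. ennreal (pmf (obs_pmf {1..k} \<xi> n i) y) \<partial>count_space A)"
  proof (rule nn_integral_cong)
    fix y
    have "(\<integral>\<^sup>+T. ennreal (pmf (tree_obs k n T i) y) \<partial>M) = ennreal (\<integral>T. pmf (tree_obs k n T i) y \<partial>M)"
      using mp by (intro nn_integral_eq_integral integrable_const_bound[of _ 1]) (auto simp: pmf_le_1)
    then show "(\<integral>\<^sup>+T. ennreal (pmf (tree_obs k n T i) y) \<partial>M) = ennreal (pmf (obs_pmf {1..k} \<xi> n i) y)"
      using M i by (simp add: law_matches_def)
  qed
  also have "\<dots> = ennreal (measure_pmf.prob (obs_pmf {1..k} \<xi> n i) A)"
    by (simp add: nn_integral_pmf measure_pmf.emeasure_eq_measure)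
  finally show "(\<integral>T. measure_pmf.prob (tree_obs k n T i) A \<partial>M) = measure_pmf.prob (obs_pmf {1..k} \<xi> n i) A"
    using meas by (subst integral_eq_nn_integral) auto
qed

text \<open>The event \<open>A\<close> may vary with the level but not with the tree. Hence the mean
  over trees of its probability difference is the difference under the joint laws, and it lies below
  the mean total variation distance.\<close>

lemma reconstructible_if_distinguishable:
  assumes M: "law_matches k \<xi> M" and ij: "i \<in> {1..k}" "j \<in> {1..k}"
    and A: "\<And>n. \<exists>A. 1 / 2 \<le> measure_pmf.prob (obs_pmf {1..k} \<xi> n i) A - measure_pmf.prob (obs_pmf {1..k} \<xi> n j) A"
  shows "reconstructible k M"
proof -
  interpret prob_space M using M by (simp add: law_matches_def)
  have "1 / 2 \<le> (\<integral>T. tv_dist (level_law k T n i) (level_law k T n j) \<partial>M)" for n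
  proof -
    obtain A where "1 / 2 \<le> measure_pmf.prob (obs_pmf {1..k} \<xi> n i) A - measure_pmf.prob (obs_pmf {1..k} \<xi> n j) A"
      using A by blast
    have int: "integrable M (\<lambda>T. measure_pmf.prob (tree_obs k n T l) A)" if "l \<in> {1..k}" for l
      using law_matches_prob(1)[OF M that] by (intro integrable_const_bound[of _ 1]) auto
    have "(\<lambda>T. tv_dist (level_law k T n i) (level_law k T n j)) \<in> borel_measurable M"
      using M measurable_cong_sets[of M tree_space] borel_measurable_tv_dist_level_law by (auto simp: law_matches_def)
    then have tv: "integrable M (\<lambda>T. tv_dist (level_law k T n i) (level_law k T n j))"
      by (intro integrable_const_bound[of _ 1]) (auto simp: tv_dist_nonneg tv_dist_le_1)
    have "1 / 2 \<le> (\<integral>T. measure_pmf.prob (tree_obs k n T i) A - measure_pmf.prob (tree_obs k n T j) A \<partial>M)"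
      using \<open>1 / 2 \<le> _\<close> ij by (simp add: int law_matches_prob(2)[OF M])
    also have "\<dots> \<le> (\<integral>T. tv_dist (level_law k T n i) (level_law k T n j) \<partial>M)"
      using int ij tv by (intro integral_mono Bochner_Integration.integrable_diff tree_obs_diff_le_tv_dist) auto
    finally show ?thesis .
  qed
  then have "ereal (1 / 2) \<le> limsup (\<lambda>n. ereal (\<integral>T. tv_dist (level_law k T n i) (level_law k T n j) \<partial>M))"
    by (intro le_Limsup) auto
  then have "0 < limsup (\<lambda>n. ereal (\<integral>T. tv_dist (level_law k T n i) (level_law k T n j) \<partial>M))"
    by (rule less_le_trans[rotated]) simp
  then show ?thesis unfolding reconstructible_def using ij by blast
qed

section \<open>Choice of the parameters\<close>

lemma eventually_parameters:
  fixes \<epsilon> :: real assumes "0 < \<epsilon>"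
  shows "\<forall>\<^sub>F k in sequentially. 35 \<le> real k \<and> exp 3 * ln (real k) \<le> real k \<and>
     (ln (ln (real k)) + 1) / ln (real k)
       + 2 * (ln (real k) + ln (ln (real k)) + 1) / (ln (real k) * (real k - 1)) \<le> \<epsilon> / 2 \<and>
     8 \<le> ln (real k)"
proof (intro eventually_conj)
  have "((\<lambda>k. (ln (ln (real k)) + 1) / ln (real k)
       + 2 * (ln (real k) + ln (ln (real k)) + 1) / (ln (real k) * (real k - 1))) \<longlongrightarrow> 0) sequentially"
    by real_asymp
  then show "\<forall>\<^sub>F k in sequentially. (ln (ln (real k)) + 1) / ln (real k)
       + 2 * (ln (real k) + ln (ln (real k)) + 1) / (ln (real k) * (real k - 1)) \<le> \<epsilon> / 2"
    using assms by (intro eventually_mono[OF order_tendstoD(2)[of _ 0 _ "\<epsilon> / 2"]]) auto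
qed real_asymp+


lemma eventually_large_enough: "eventually large_enough sequentially"
  using eventually_parameters[OF gain_bounds(1)] by eventually_elim (simp add: large_enough_def)

theorem theorem1p1:
  "\<exists>(k0::nat) (\<beta>::real). \<beta> < 1 \<and>
     (\<forall>k\<ge>k0.
        (\<forall>d::nat. real d \<ge> real k * (ln (real k) + ln (ln (real k)) + \<beta>) \<longrightarrow>
           reconstructible k (regular_tree d)) \<and>
        (\<forall>d::real. d \<ge> real k * (ln (real k) + ln (ln (real k)) + \<beta>) \<longrightarrow>
           reconstructible k (gw_tree (poisson_pmf d))))"
proof -
  obtain k0 where k0: "\<And>k. k \<ge> k0 \<Longrightarrow> large_enough k"
    using eventually_large_enough by (auto simp: eventually_sequentially)
  have rec: "reconstructible k M"
    if "k \<ge> k0" and M: "law_matches k \<xi> M" and \<xi>: "poisson_like \<xi> d"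
      and d: "real k * (ln (real k) + ln (ln (real k)) + (1 - gain / 2)) \<le> d" for k \<xi> M d
  proof (rule reconstructible_if_distinguishable[OF M])
    have large: "large_enough (card {1..k})" using k0 that(1) by simp
    then have "2 \<le> k" by (simp add: large_enough_def)
    then show "1 \<in> {1..k}" "2 \<in> {1..k}" by auto
    then show "\<exists>A. 1 / 2 \<le> measure_pmf.prob (obs_pmf {1..k} \<xi> n 1) A - measure_pmf.prob (obs_pmf {1..k} \<xi> n 2) A" for n
      using d by (intro obs_pmf_distinguishable[OF _ large \<xi>]) auto
  qed
  show ?thesis
  proof (intro exI[of _ k0] exI[of _ "1 - gain / 2"] conjI allI impI)
    show "1 - gain / 2 < 1" using gain_bounds by simp
  next
    fix k d :: nat
    assume "k0 \<le> k" "real k * (ln (real k) + ln (ln (real k)) + (1 - gain / 2)) \<le> real d"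
    then show "reconstructible k (regular_tree d)"
      by (intro rec[OF _ law_matches_regular poisson_like_return])
  next
    fix k :: nat and d :: real
    assume k: "k0 \<le> k" and d: "real k * (ln (real k) + ln (ln (real k)) + (1 - gain / 2)) \<le> d"
    \<comment> \<open>The Poisson generating function is available for positive mean, and the
      hypothesis on \<open>d\<close> provides positivity.\<close>
    have L: "35 \<le> real k" "8 \<le> ln (real k)" using k0[OF k] by (simp_all add: large_enough_def)
    moreover have "0 \<le> ln (ln (real k))" using L by simp
    ultimately have "0 < ln (real k) + ln (ln (real k)) + (1 - gain / 2)"
      using gain_bounds by linarith
    then have "0 < real k * (ln (real k) + ln (ln (real k)) + (1 - gain / 2))"
      using L by simp
    then have "0 < d" using d by linarith
    then show "reconstructible k (gw_tree (poisson_pmf d))"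
      using L by (intro rec[OF k law_matches_gw poisson_like_poisson d]) auto
  qed
qed

end
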